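(* Let $n\ge1$ be an integer, $b>0$ real and $k\ge 2n$ an integer. Let $\gamma_h(t)$ be an arbitrary homoclinic geodesic in $J^k(\mathbb{R},\mathbb{R})$ for the polynomial $F_h(x):=\pm(1-bx^{2n})$ (either sign), and let $c_h(t):=\pi_{F_h}(\gamma_h(t))$. Then $c_h(t)$ is a metric line in the magnetic space $\mathbb{R}^3_{F_h}$.
   Context: **The sub-Riemannian manifold $J^k(\mathbb{R},\mathbb{R})$.** It is $\mathbb{R}^{k+2}$ with global coordinates $(x,\theta_0,\dots,\theta_k)$, with rank-2 distribution framed by the orthonormal vector fields $X=\frac{\partial}{\partial x}$ and $Y=\sum_{i=0}^k\frac{x^i}{i!}\frac{\partial}{\partial\theta_i}$. **Hill interval.** For a polynomial $F$, a closed interval $I$ is a hill interval of $F$ if $|F|<1$ in the interior of $I$ and $|F|=1$ on the boundary of $I$. **Geodesics in $J^k(\mathbb{R},\mathbb{R})$.** Let $F$ be a polynomial of degree at most $k$ and $I$ a hill interval of $F$. A geodesic corresponding to $(F,I)$ is a curve $\gamma:\mathbb{R}\to J^k(\mathbb{R},\mathbb{R})$ satisfying $\dot\gamma=\dot x\,X(\gamma)+F(x)\,Y(\gamma)$, where $(p_x(t),x(t))$, with $\dot x=p_x$ and $x(t)\in I$, solves the Hamiltonian system $H_F=\frac12(p_x^2+F^2(x))$ with energy $\frac12$. For $F$ non-constant and $I=[x_0,x_1]$, the geodesic is homoclinic if its reduced dynamics $(p_x(t),x(t))$ is a (non-constant) homoclinic orbit, which occurs exactly when one of $x_0,x_1$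 is a regular point of $F$ and the other a critical point of $F$. **Magnetic space.** For a polynomial $F(x)=\sum_{i=0}^k a_ix^i$, $\mathbb{R}^3_F$ is $\mathbb{R}^3$ with coordinates $(x,y,z)$, the rank-2 distribution $\mathcal{D}_F=\ker(dz-F(x)\,dy)$ and the metric $(dx^2+dy^2)|_{\mathcal{D}_F}$; an orthonormal frame is $\tilde X=\frac{\partial}{\partial x}$, $\tilde Y=\frac{\partial}{\partial y}+F(x)\frac{\partial}{\partial z}$. The map $\pi_F:J^k(\mathbb{R},\mathbb{R})\to\mathbb{R}^3_F$ is $\pi_F(x,\theta_0,\dots,\theta_k)=\left(x,\theta_0,\sum_{\ell=0}^k \ell!\,a_\ell\theta_\ell\right)$; it satisfies $(\pi_F)_*X=\tilde X$ and $(\pi_F)_*Y=\tilde Y$. **Metric line.** With $\mathrm{dist}_M$ the sub-Riemannian distance (infimum of lengths of absolutely continuous horizontal curves), a geodesic $\gamma:\mathbb{R}\to M$ is a metric line if $|a-b|=\mathrm{dist}_M(\gamma(a),\gamma(b))$ for every compact interval $[a,b]\subset\mathbb{R}$. *)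

theory Defs
  imports "HOL-Analysis.Analysis" "HOL-Computational_Algebra.Polynomial"
begin

section \<open>Sub-Riemannian structures on a Euclidean space\<close>

definition absolutely_continuous_curve ::
    "real \<Rightarrow> real \<Rightarrow> (real \<Rightarrow> 'a::euclidean_space) \<Rightarrow> bool" where
  "absolutely_continuous_curve a b \<gamma> \<longleftrightarrow>
     (\<forall>\<epsilon>>0. \<exists>\<delta>>0. \<forall>\<D> S. \<D> division_of S \<and> S \<subseteq> {a..b} \<and> (\<Sum>J\<in>\<D>. measure lborel J) < \<delta> \<longrightarrow>
        (\<Sum>J\<in>\<D>. norm (\<gamma> (Sup J) - \<gamma> (Inf J))) < \<epsilon>)"

text \<open>
  A sub-Riemannian structure is given by \<open>D\<close>, where \<open>D p\<close> is the set of horizontal vectors at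
  \<open>p\<close>, and \<open>g\<close>, where \<open>g p\<close> is an inner product on \<open>D p\<close>. The values of \<open>g p\<close> outside \<open>D p\<close> are
  irrelevant.
\<close>

definition horizontal_curve ::
    "('a::euclidean_space \<Rightarrow> 'a set) \<Rightarrow> real \<Rightarrow> real \<Rightarrow> (real \<Rightarrow> 'a) \<Rightarrow> bool" where
  "horizontal_curve D a b \<gamma> \<longleftrightarrow>
     absolutely_continuous_curve a b \<gamma> \<and>
     (AE t in lebesgue. t \<in> {a..b} \<longrightarrow> (\<exists>v \<in> D (\<gamma> t). (\<gamma> has_vector_derivative v) (at t within {a..b})))"

definition sr_length ::
    "('a::euclidean_space \<Rightarrow> 'a \<Rightarrow> 'a \<Rightarrow> real) \<Rightarrow> real \<Rightarrow> real \<Rightarrow> (real \<Rightarrow> 'a) \<Rightarrow> ennreal" where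
  "sr_length g a b \<gamma> =
     (\<integral>\<^sup>+t\<in>{a..b}. ennreal (let v = vector_derivative \<gamma> (at t within {a..b}) in sqrt (g (\<gamma> t) v v)) \<partial>lebesgue)"

text \<open>With values in \<open>ennreal\<close>, the distance of points not joined by a horizontal curve is \<open>\<infinity>\<close>.\<close>

definition sr_dist ::
    "('a::euclidean_space \<Rightarrow> 'a set) \<Rightarrow> ('a \<Rightarrow> 'a \<Rightarrow> 'a \<Rightarrow> real) \<Rightarrow> 'a \<Rightarrow> 'a \<Rightarrow> ennreal" where
  "sr_dist D g p q =
     Inf {sr_length g a b \<gamma> | a b \<gamma>. a \<le> b \<and> horizontal_curve D a b \<gamma> \<and> \<gamma> a = p \<and> \<gamma> b = q}"

text \<open>Geodesics are parametrized by arc length and locally length minimizing.\<close>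

definition sr_geodesic ::
    "('a::euclidean_space \<Rightarrow> 'a set) \<Rightarrow> ('a \<Rightarrow> 'a \<Rightarrow> 'a \<Rightarrow> real) \<Rightarrow> (real \<Rightarrow> 'a) \<Rightarrow> bool" where
  "sr_geodesic D g \<gamma> \<longleftrightarrow>
     (\<forall>a b. a \<le> b \<longrightarrow> horizontal_curve D a b \<gamma> \<and> sr_length g a b \<gamma> = ennreal (b - a)) \<and>
     (\<forall>t. \<exists>\<epsilon>>0. \<forall>a b. t - \<epsilon> < a \<and> a \<le> b \<and> b < t + \<epsilon> \<longrightarrow>
        sr_length g a b \<gamma> = sr_dist D g (\<gamma> a) (\<gamma> b))"

definition metric_line ::
    "('a::euclidean_space \<Rightarrow> 'a set) \<Rightarrow> ('a \<Rightarrow> 'a \<Rightarrow> 'a \<Rightarrow> real) \<Rightarrow> (real \<Rightarrow> 'a) \<Rightarrow> bool" where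
  "metric_line D g \<gamma> \<longleftrightarrow>
     sr_geodesic D g \<gamma> \<and> (\<forall>a b. a \<le> b \<longrightarrow> ennreal \<bar>a - b\<bar> = sr_dist D g (\<gamma> a) (\<gamma> b))"

section \<open>The reduced Hamiltonian system\<close>

definition hill_interval :: "real poly \<Rightarrow> real set \<Rightarrow> bool" where
  "hill_interval F I \<longleftrightarrow>
     closed I \<and> is_interval I \<and> I \<noteq> {} \<and>
     (\<forall>x \<in> interior I. \<bar>poly F x\<bar> < 1) \<and> (\<forall>x \<in> frontier I. \<bar>poly F x\<bar> = 1)"

definition hamiltonian :: "real poly \<Rightarrow> real \<Rightarrow> real \<Rightarrow> real" where
  "hamiltonian F p x = (p\<^sup>2 + (poly F x)\<^sup>2) / 2"

definition hamiltonian_solution :: "real poly \<Rightarrow> (real \<Rightarrow> real) \<Rightarrow> (real \<Rightarrow> real) \<Rightarrow> bool" where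
  "hamiltonian_solution F p x \<longleftrightarrow>
     (\<forall>t. (x has_real_derivative deriv (\<lambda>q. hamiltonian F q (x t)) (p t)) (at t) \<and>
          (p has_real_derivative - deriv (\<lambda>y. hamiltonian F (p t) y) (x t)) (at t))"

definition equilibrium :: "real poly \<Rightarrow> real \<Rightarrow> real \<Rightarrow> bool" where
  "equilibrium F p x \<longleftrightarrow>
     deriv (\<lambda>q. hamiltonian F q x) p = 0 \<and> deriv (\<lambda>y. hamiltonian F p y) x = 0"

definition homoclinic_orbit :: "real poly \<Rightarrow> (real \<Rightarrow> real) \<Rightarrow> (real \<Rightarrow> real) \<Rightarrow> bool" where
  "homoclinic_orbit F p x \<longleftrightarrow>
     hamiltonian_solution F p x \<and> \<not> (\<lambda>t. (p t, x t)) constant_on UNIV \<and>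
     (\<exists>p0 x0. equilibrium F p0 x0 \<and>
        ((\<lambda>t. (p t, x t)) \<longlongrightarrow> (p0, x0)) at_top \<and> ((\<lambda>t. (p t, x t)) \<longlongrightarrow> (p0, x0)) at_bot)"

section \<open>Geodesics in the jet space\<close>

text \<open>
  A point \<open>(x, \<theta>\<^sub>0, \<dots>, \<theta>\<^sub>k)\<close> of the jet space is the pair \<open>(x, \<theta>)\<close> with \<open>\<theta> i = 0\<close> for \<open>i > k\<close>;
  tangent vectors are represented in the same way.
\<close>

type_synonym jet = "real \<times> (nat \<Rightarrow> real)"

definition jet_space :: "nat \<Rightarrow> jet set" where
  "jet_space k = {q. \<forall>i>k. snd q i = 0}"

definition jet_X :: "jet \<Rightarrow> jet" where
  "jet_X q = (1, \<lambda>i. 0)"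

definition jet_Y :: "nat \<Rightarrow> jet \<Rightarrow> jet" where
  "jet_Y k q = (0, \<lambda>i. if i \<le> k then fst q ^ i / fact i else 0)"

definition jet_lincomb :: "real \<Rightarrow> jet \<Rightarrow> real \<Rightarrow> jet \<Rightarrow> jet" where
  "jet_lincomb a v b w = (a * fst v + b * fst w, \<lambda>i. a * snd v i + b * snd w i)"

definition has_jet_velocity :: "(real \<Rightarrow> jet) \<Rightarrow> jet \<Rightarrow> real \<Rightarrow> bool" where
  "has_jet_velocity \<gamma> v t \<longleftrightarrow>
     ((\<lambda>s. fst (\<gamma> s)) has_real_derivative fst v) (at t) \<and>
     (\<forall>i. ((\<lambda>s. snd (\<gamma> s) i) has_real_derivative snd v i) (at t))"

definition jet_x :: "(real \<Rightarrow> jet) \<Rightarrow> real \<Rightarrow> real" where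
  "jet_x \<gamma> t = fst (\<gamma> t)"

definition jet_p :: "(real \<Rightarrow> jet) \<Rightarrow> real \<Rightarrow> real" where
  "jet_p \<gamma> = deriv (jet_x \<gamma>)"

definition jet_geodesic :: "nat \<Rightarrow> real poly \<Rightarrow> real set \<Rightarrow> (real \<Rightarrow> jet) \<Rightarrow> bool" where
  "jet_geodesic k F I \<gamma> \<longleftrightarrow>
     degree F \<le> k \<and> hill_interval F I \<and>
     (\<forall>t. \<gamma> t \<in> jet_space k \<and> jet_x \<gamma> t \<in> I) \<and>
     (\<forall>t. has_jet_velocity \<gamma>
            (jet_lincomb (jet_p \<gamma> t) (jet_X (\<gamma> t)) (poly F (jet_x \<gamma> t)) (jet_Y k (\<gamma> t))) t) \<and>
     hamiltonian_solution F (jet_p \<gamma>) (jet_x \<gamma>) \<and>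
     (\<forall>t. hamiltonian F (jet_p \<gamma> t) (jet_x \<gamma> t) = 1/2)"

definition homoclinic_geodesic :: "nat \<Rightarrow> real poly \<Rightarrow> (real \<Rightarrow> jet) \<Rightarrow> bool" where
  "homoclinic_geodesic k F \<gamma> \<longleftrightarrow>
     0 < degree F \<and> (\<exists>x0 x1. jet_geodesic k F {x0..x1} \<gamma>) \<and>
     homoclinic_orbit F (jet_p \<gamma>) (jet_x \<gamma>)"

section \<open>The magnetic space\<close>

definition magnetic_distribution ::
    "real poly \<Rightarrow> real \<times> real \<times> real \<Rightarrow> (real \<times> real \<times> real) set" where
  "magnetic_distribution F = (\<lambda>(x, y, z). {(dx, dy, dz). dz - poly F x * dy = 0})"

definition magnetic_metric ::
    "real \<times> real \<times> real \<Rightarrow> real \<times> real \<times> real \<Rightarrow> real \<times> real \<times> real \<Rightarrow> real" where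
  "magnetic_metric q = (\<lambda>(dx, dy, dz) (dx', dy', dz'). dx * dx' + dy * dy')"

definition magnetic_projection :: "nat \<Rightarrow> real poly \<Rightarrow> jet \<Rightarrow> real \<times> real \<times> real" where
  "magnetic_projection k F = (\<lambda>(x, \<theta>). (x, \<theta> 0, \<Sum>l=0..k. fact l * coeff F l * \<theta> l))"

end

theory Submission
  imports Defs
begin

text \<open>
  A geodesic is shown to be a metric line by calibrations. Write \<open>F = \<epsilon> * (1 - b * x ^ (2 * n))\<close> with
  \<open>\<epsilon> = \<plusminus>1\<close>, and let \<open>width\<close> be the largest \<open>\<bar>x\<bar>\<close> on the homoclinic geodesic.

  For every \<open>M > 0\<close> the polynomial \<open>F\<^sub>M = 1 - 2 * (x / M) ^ (2 * n)\<close> is an affine combination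
  \<open>(1 + \<mu>) - \<mu> * \<epsilon> * F\<close>. Hence the two functions \<open>(1 + \<mu>) * \<epsilon> * y - \<mu> * z \<plusminus> K\<^sub>M x\<close>, where \<open>K\<^sub>M\<close> is an
  antiderivative of \<open>sqrt (1 - F\<^sub>M\<^sup>2)\<close>, have a horizontal gradient of norm one on \<open>\<bar>x\<bar> \<le> M\<close>, and their
  increments bound the lengths of curves in that region from below. For \<open>M = width\<close> the geodesic
  follows these gradients, but the sign in front of \<open>K\<^sub>M\<close> changes at the turning time, and competitors
  may leave the region. One calibration is therefore not enough.

  Instead, \<open>M\<close> is adapted to the competitor: it is the maximum of \<open>\<bar>x\<bar>\<close> along it. Using one sign of
  \<open>K\<^sub>M\<close> up to the point where the maximum is attained and the other sign after it, the length of the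
  competitor is at least the duration of the geodesic segment plus a quantity \<open>excess\<close> that depends
  on \<open>M\<close> and the segment only (\<open>duration_le_length\<close>). Suppose that the geodesic stays in \<open>\<bar>x\<bar> \<le> M\<close>
  before and after the segment. Then, by the Cauchy-Schwarz inequality, the excess does not increase
  when the segment is extended (\<open>excess_antimono\<close>), so it is bounded below by its limit over the
  whole homoclinic loop. Here the homogeneity of \<open>x ^ (2 * n)\<close> enters: a virial identity
  and the calibration for \<open>M = width\<close> determine the increments of \<open>Y - Z\<close> and \<open>t - Z\<close> over the loop, where
  \<open>Y = \<epsilon> * y\<close> and \<open>Z = z\<close>. With \<open>r = width / M\<close> the limit of the excess is a positive multiple of
  \<open>r ^ (2 * n + 1) - (2 * n + 1) * r + 2 * n\<close>, which is nonnegative by Bernoulli's inequality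
  (\<open>excess_limit_nonneg\<close>). If the geodesic does leave \<open>\<bar>x\<bar> \<le> M\<close> outside the segment, then \<open>M < width\<close> and
  the segment avoids the turning time, and a single calibration with parameter \<open>width\<close> suffices.

  The analytic input is the fundamental theorem of calculus for absolutely continuous curves, which
  turns a pointwise bound on the gradient into a bound on the length of every horizontal curve.
\<close>

section \<open>Absolutely continuous curves\<close>

lemma absolutely_continuous_curve_subinterval:
  assumes "absolutely_continuous_curve a b f" "a \<le> c" "d \<le> b"
  shows "absolutely_continuous_curve c d f"
  unfolding absolutely_continuous_curve_def
proof (intro allI impI)
  fix e :: real assume "e > 0"
  then obtain dl where "dl > 0" and dl: "\<And>\<D> S. \<lbrakk>\<D> division_of S; S \<subseteq> {a..b}; (\<Sum>J\<in>\<D>. measure lborel J) < dl\<rbrakk>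
        \<Longrightarrow> (\<Sum>J\<in>\<D>. norm (f (Sup J) - f (Inf J))) < e"
    using assms(1) unfolding absolutely_continuous_curve_def by meson
  moreover have "{c..d} \<subseteq> {a..b}" using assms by auto
  ultimately show "\<exists>dl>0. \<forall>\<D> S. \<D> division_of S \<and> S \<subseteq> {c..d} \<and> (\<Sum>J\<in>\<D>. measure lborel J) < dl \<longrightarrow>
        (\<Sum>J\<in>\<D>. norm (f (Sup J) - f (Inf J))) < e"
    by (meson order_trans)
qed

lemma absolutely_continuous_curve_lipschitz_comp:
  fixes f :: "real \<Rightarrow> 'a::euclidean_space" and S :: "'a \<Rightarrow> 'b::euclidean_space"
  assumes f: "absolutely_continuous_curve a b f" and S: "L-lipschitz_on UNIV S"
  shows "absolutely_continuous_curve a b (\<lambda>t. S (f t))"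
  unfolding absolutely_continuous_curve_def
proof (intro allI impI)
  fix e :: real assume "e > 0"
  have L: "L \<ge> 0" using S by (rule lipschitz_on_nonneg)
  have "e / (L+1) > 0" using \<open>e > 0\<close> L by simp
  then obtain dl where "dl > 0" and dl: "\<And>\<D> S. \<lbrakk>\<D> division_of S; S \<subseteq> {a..b}; (\<Sum>J\<in>\<D>. measure lborel J) < dl\<rbrakk>
        \<Longrightarrow> (\<Sum>J\<in>\<D>. norm (f (Sup J) - f (Inf J))) < e / (L+1)"
    using f unfolding absolutely_continuous_curve_def by meson
  show "\<exists>dl>0. \<forall>\<D> T. \<D> division_of T \<and> T \<subseteq> {a..b} \<and> (\<Sum>J\<in>\<D>. measure lborel J) < dl \<longrightarrow>
        (\<Sum>J\<in>\<D>. norm (S (f (Sup J)) - S (f (Inf J)))) < e"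
  proof (intro exI[of _ dl] conjI allI impI)
    fix \<D> T assume *: "\<D> division_of T \<and> T \<subseteq> {a..b} \<and> (\<Sum>J\<in>\<D>. measure lborel J) < dl"
    have "(\<Sum>J\<in>\<D>. norm (S (f (Sup J)) - S (f (Inf J)))) \<le> (\<Sum>J\<in>\<D>. (L+1) * norm (f (Sup J) - f (Inf J)))"
    proof (rule sum_mono)
      fix J
      have "norm (S (f (Sup J)) - S (f (Inf J))) \<le> L * norm (f (Sup J) - f (Inf J))"
        using lipschitz_onD[OF S, of "f (Sup J)" "f (Inf J)"] by (simp add: dist_norm)
      then show "norm (S (f (Sup J)) - S (f (Inf J))) \<le> (L+1) * norm (f (Sup J) - f (Inf J))"
        by (simp add: distrib_right add_increasing2)
    qed
    also have "\<dots> = (L+1) * (\<Sum>J\<in>\<D>. norm (f (Sup J) - f (Inf J)))"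
      by (simp add: sum_distrib_left)
    also have "\<dots> < (L+1) * (e / (L+1))"
      using dl * L by (intro mult_strict_left_mono) auto
    also have "\<dots> = e" using L by simp
    finally show "(\<Sum>J\<in>\<D>. norm (S (f (Sup J)) - S (f (Inf J)))) < e" .
  qed (fact \<open>dl > 0\<close>)
qed

lemma absolutely_continuous_curve_lipschitz:
  fixes f :: "real \<Rightarrow> 'a::euclidean_space"
  assumes f: "L-lipschitz_on UNIV f"
  shows "absolutely_continuous_curve a b f"
proof -
  have "absolutely_continuous_curve a b (\<lambda>t::real. t)"
    unfolding absolutely_continuous_curve_def
  proof (intro allI impI)
    fix e :: real assume "e > 0"
    show "\<exists>dl>0. \<forall>\<D> T. \<D> division_of T \<and> T \<subseteq> {a..b} \<and> (\<Sum>J\<in>\<D>. measure lborel J) < dl \<longrightarrow>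
        (\<Sum>J\<in>\<D>. norm (Sup J - Inf J)) < e"
    proof (intro exI[of _ e] conjI allI impI)
      fix \<D> T assume *: "\<D> division_of T \<and> T \<subseteq> {a..b} \<and> (\<Sum>J\<in>\<D>. measure lborel J) < e"
      have "(\<Sum>J\<in>\<D>. norm (Sup J - Inf J)) = (\<Sum>J\<in>\<D>. measure lborel J)"
      proof (rule sum.cong)
        fix J assume "J \<in> \<D>"
        then obtain u v :: real where "J = cbox u v" "J \<noteq> {}" using * by blast
        then show "norm (Sup J - Inf J) = measure lborel J" by auto
      qed simp
      then show "(\<Sum>J\<in>\<D>. norm (Sup J - Inf J)) < e" using * by simp
    qed (fact \<open>e > 0\<close>)
  qed
  from absolutely_continuous_curve_lipschitz_comp[OF this f] show ?thesis .
qed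

lemma absolutely_continuous_curve_imp_continuous_on:
  fixes f :: "real \<Rightarrow> 'a::euclidean_space"
  assumes "absolutely_continuous_curve a b f"
  shows "continuous_on {a..b} f"
  unfolding continuous_on_iff
proof (intro ballI allI impI)
  fix x e :: real assume x: "x \<in> {a..b}" and "e > 0"
  obtain dl where "dl > 0" and dl: "\<And>\<D> S. \<lbrakk>\<D> division_of S; S \<subseteq> {a..b}; (\<Sum>J\<in>\<D>. measure lborel J) < dl\<rbrakk>
        \<Longrightarrow> (\<Sum>J\<in>\<D>. norm (f (Sup J) - f (Inf J))) < e"
    using assms \<open>e > 0\<close> unfolding absolutely_continuous_curve_def by meson
  have *: "norm (f v - f u) < e" if "u \<le> v" "a \<le> u" "v \<le> b" "v - u < dl" for u v
    using dl[of "{{u..v}}" "{u..v}"] division_of_self[of u v] that by simp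
  show "\<exists>d>0. \<forall>y\<in>{a..b}. dist y x < d \<longrightarrow> dist (f y) (f x) < e"
  proof (intro exI[of _ dl] conjI ballI impI \<open>dl > 0\<close>)
    fix y assume "y \<in> {a..b}" "dist y x < dl"
    then show "dist (f y) (f x) < e"
      using *[of x y] *[of y x] x by (cases "x \<le> y") (auto simp: dist_norm norm_minus_commute)
  qed
qed

text \<open>
  The gauge treats the two kinds of tags differently. At tags outside \<open>N\<close> it is the gauge of the
  classical theorem. At tags in \<open>N\<close> it keeps the intervals inside an open set of small measure
  containing \<open>N\<close>, and absolute continuity bounds the total increment of \<open>f\<close> over these intervals.
\<close>

lemma fundamental_theorem_of_calculus_absolutely_continuous:
  fixes f :: "real \<Rightarrow> 'a::euclidean_space"
  assumes "a \<le> b" and ac: "absolutely_continuous_curve a b f" and N: "negligible N"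
    and vecd: "\<And>x. x \<in> {a..b} - N \<Longrightarrow> (f has_vector_derivative f' x) (at x within {a..b})"
  shows "(f' has_integral (f b - f a)) {a..b}"
proof -
  define g where "g x = (if x \<in> N then 0 else f' x)" for x
  have "(g has_integral (f b - f a)) {a..b}"
    unfolding has_integral_real
  proof (intro allI impI)
    fix e0 :: real
    assume "e0 > 0"
    define e where "e = e0 / (2 * (b - a + 1))"
    have "e > 0" using \<open>e0 > 0\<close> \<open>a \<le> b\<close> by (simp add: e_def)
    then have "\<forall>x. \<exists>d>0. x \<in> {a..b} - N \<longrightarrow>
           (\<forall>y\<in>{a..b}. norm (y-x) < d \<longrightarrow> norm (f y - f x - (y-x) *\<^sub>R f' x) \<le> e * norm (y-x))"
      using vecd[unfolded has_vector_derivative_def has_derivative_within_alt] by blast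
    then obtain d where d0: "\<And>x. 0 < d x"
                   and d: "\<And>x y. \<lbrakk>x \<in> {a..b} - N; y \<in> {a..b}; norm (y-x) < d x\<rbrakk>
                          \<Longrightarrow> norm (f y - f x - (y-x) *\<^sub>R f' x) \<le> e * norm (y-x)"
      by metis
    obtain dl where "dl > 0" and dl: "\<And>\<D> S. \<lbrakk>\<D> division_of S; S \<subseteq> {a..b}; (\<Sum>J\<in>\<D>. measure lborel J) < dl\<rbrakk>
        \<Longrightarrow> (\<Sum>J\<in>\<D>. norm (f (Sup J) - f (Inf J))) < e0 / 2"
      using ac \<open>e0 > 0\<close> unfolding absolutely_continuous_curve_def by (meson half_gt_zero)
    have N0: "N \<in> null_sets lebesgue" using N by (simp add: negligible_iff_null_sets)
    then obtain U where U: "open U" "N \<subseteq> U" "U - N \<in> lmeasurable" "emeasure lebesgue (U - N) < ennreal dl"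
      using sets_lebesgue_outer_open[of N dl] \<open>dl > 0\<close> by (auto simp: null_sets_def)
    have "emeasure lebesgue U \<le> emeasure lebesgue (U - N) + emeasure lebesgue N"
      using N0 U by (intro order_trans[OF emeasure_mono emeasure_subadditive]) auto
    with N0 U have Ue: "emeasure lebesgue U < ennreal dl" by (auto simp: null_sets_def)
    have Um: "U \<in> lmeasurable"
      using Ue U by (intro fmeasurableI) (auto simp: less_top[symmetric] order_less_trans)
    have Udl: "measure lebesgue U < dl"
      using Ue Um \<open>dl > 0\<close> by (simp add: emeasure_eq_measure2 ennreal_less_iff)
    have "\<forall>x\<in>N. \<exists>r>0. ball x r \<subseteq> U" using U by (meson open_contains_ball subsetD)
    then obtain r where r: "\<And>x. x \<in> N \<Longrightarrow> r x > 0 \<and> ball x (r x) \<subseteq> U" by metis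
    define \<gamma> where "\<gamma> x = (if x \<in> N then ball x (r x) else ball x (d x))" for x
    have "gauge \<gamma>" using r d0 by (auto simp: \<gamma>_def gauge_def)
    show "\<exists>\<gamma>. gauge \<gamma> \<and> (\<forall>p. p tagged_division_of {a..b} \<and> \<gamma> fine p \<longrightarrow>
      norm ((\<Sum>(x, k)\<in>p. measure lborel k *\<^sub>R g x) - (f b - f a)) < e0)"
    proof (intro exI[of _ \<gamma>] conjI allI impI \<open>gauge \<gamma>\<close>)
      fix p
      assume "p tagged_division_of {a..b} \<and> \<gamma> fine p"
      then have ptag: "p tagged_division_of {a..b}" and finep: "\<gamma> fine p" by auto
      have finp: "finite p" using ptag by auto
      have ba: "b - a = (\<Sum>(x,K)\<in>p. Sup K - Inf K)" "f b - f a = (\<Sum>(x,K)\<in>p. f(Sup K) - f(Inf K))"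
        using additive_tagged_division_1[where f= "\<lambda>x. x"] additive_tagged_division_1[where f= f]
              \<open>a \<le> b\<close> ptag by auto
      have K_int: "\<exists>u v. u \<le> v \<and> K = {u..v} \<and> x \<in> K \<and> K \<subseteq> {a..b}" if "(x,K) \<in> p" for x K
      proof -
        from ptag that obtain u v where "K = cbox u v" "x \<in> K" "K \<subseteq> {a..b}" 
          by (meson tagged_division_ofD(2,3,4))
        then show ?thesis by (intro exI[of _ u] exI[of _ v]) auto
      qed
      have K_ne: "K \<noteq> {}" if "(x,K) \<in> p" for x K using K_int[OF that] by auto
      define pN where "pN = {z\<in>p. fst z \<in> N}"
      define pG where "pG = {z\<in>p. fst z \<notin> N}"
      have p_split: "p = pN \<union> pG" "pN \<inter> pG = {}" "finite pN" "finite pG"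
        using finp by (auto simp: pN_def pG_def)
      have pN_tag: "pN tagged_partial_division_of {a..b}"
        using ptag unfolding tagged_division_of_def
        by (elim conjE tagged_partial_division_subset) (auto simp: pN_def)
      let ?h = "\<lambda>(x,K). measure lborel K *\<^sub>R g x - (f(Sup K) - f(Inf K))"
      have "(\<Sum>(x, k)\<in>p. measure lborel k *\<^sub>R g x) - (f b - f a) = sum ?h p"
        unfolding ba by (simp add: sum_subtractf split_def)
      also have "\<dots> = sum ?h pN + sum ?h pG"
        unfolding p_split(1) by (rule sum.union_disjoint) (use p_split in auto)
      finally have eq: "(\<Sum>(x, k)\<in>p. measure lborel k *\<^sub>R g x) - (f b - f a) = sum ?h pN + sum ?h pG" .
      have G: "norm (sum ?h pG) \<le> (\<Sum>(x,K)\<in>p. e * (Sup K - Inf K))"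
      proof -
        have "norm (sum ?h pG) \<le> (\<Sum>(x,K)\<in>pG. e * (Sup K - Inf K))"
        proof (rule sum_norm_le, clarify)
          fix x K assume "(x,K) \<in> pG"
          then have xK: "(x,K) \<in> p" "x \<notin> N" by (auto simp: pG_def)
          then obtain u v where uv: "u \<le> v" "K = {u..v}" "x \<in> K" "K \<subseteq> {a..b}" using K_int by blast
          have "K \<subseteq> ball x (d x)" using fineD[OF finep xK(1)] xK(2) by (simp add: \<gamma>_def)
          moreover have "u \<in> K" "v \<in> K" using uv by auto
          ultimately have nu: "norm (u - x) < d x" and nv: "norm (v - x) < d x"
            by (auto simp: dist_real_def subset_iff)
          have xin: "x \<in> {a..b} - N" using xK uv by auto
          have "norm ((v - u) *\<^sub>R f' x - (f v - f u)) = norm (f u - f x - (u - x) *\<^sub>R f' x - (f v - f x - (v - x) *\<^sub>R f' x))"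
            by (auto simp: algebra_simps)
          also have "\<dots> \<le> norm (f u - f x - (u - x) *\<^sub>R f' x) + norm (f v - f x - (v - x) *\<^sub>R f' x)"
            by (rule norm_triangle_ineq4)
          also have "\<dots> \<le> e * norm (u - x) + e * norm (v - x)"
            using uv by (intro add_mono d[OF xin _ nu] d[OF xin _ nv]) auto
          also have "\<dots> = e * (v - u)" using uv by (auto simp: algebra_simps)
          finally show "norm (measure lborel K *\<^sub>R g x - (f(Sup K) - f(Inf K))) \<le> e * (Sup K - Inf K)"
            using uv xK by (simp add: g_def)
        qed
        also have "\<dots> \<le> (\<Sum>(x,K)\<in>p. e * (Sup K - Inf K))"
        proof (rule sum_mono2[OF finp])
          show "pG \<subseteq> p" by (auto simp: pG_def)
          fix z assume "z \<in> p - pG"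
          then show "0 \<le> (case z of (x,K) \<Rightarrow> e * (Sup K - Inf K))"
            using K_int[of "fst z" "snd z"] \<open>e > 0\<close> by (force simp: split_def)
        qed
        finally show ?thesis .
      qed
      also have "(\<Sum>(x,K)\<in>p. e * (Sup K - Inf K)) = e * (b - a)"
        unfolding ba(1) by (simp add: sum_distrib_left split_def)
      also have "\<dots> < e0 / 2"
      proof -
        have "e * (b - a) < e * (b - a + 1)" using \<open>e > 0\<close> by simp
        also have "\<dots> = e0 / 2" using \<open>a \<le> b\<close> by (simp add: e_def field_simps)
        finally show ?thesis .
      qed
      finally have G: "norm (sum ?h pG) < e0 / 2" .
      have "norm (sum ?h pN) \<le> (\<Sum>(x,K)\<in>pN. norm (f (Sup K) - f (Inf K)))"
        by (rule sum_norm_le) (auto simp: pN_def g_def norm_minus_commute)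
      also have "\<dots> = (\<Sum>K\<in>snd ` pN. norm (f (Sup K) - f (Inf K)))"
      proof -
        \<comment> \<open>Several tags can carry the same degenerate interval, so the sum over tags is a sum over
          intervals only because degenerate intervals contribute nothing; the empty interval,
          where \<open>Sup\<close> and \<open>Inf\<close> are arbitrary, has to be set to zero by hand.\<close>
        define h where "h K = (if K = {} then 0 else norm (f (Sup K) - f (Inf K)))" for K
        have "pN tagged_division_of (\<Union>(snd ` pN))"
          by (rule tagged_partial_division_of_Union_self[OF pN_tag])
        then have "(\<Sum>(x,K)\<in>pN. h K) = sum h (snd ` pN)"
        proof (rule sum.over_tagged_division_lemma)
          fix u v :: real assume "box u v = {}"
          then show "h (cbox u v) = 0" by (cases "u = v") (auto simp: h_def)
        qed
        moreover have "(\<Sum>(x,K)\<in>pN. norm (f (Sup K) - f (Inf K))) = (\<Sum>(x,K)\<in>pN. h K)"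
          using K_ne by (intro sum.cong) (auto simp: h_def pN_def)
        moreover have "(\<Sum>K\<in>snd ` pN. norm (f (Sup K) - f (Inf K))) = sum h (snd ` pN)"
          using K_ne by (intro sum.cong) (auto simp: h_def pN_def)
        ultimately show ?thesis by simp
      qed
      also have "\<dots> < e0 / 2"
      proof (rule dl)
        show div: "snd ` pN division_of \<Union>(snd ` pN)"
          by (rule partial_division_of_tagged_division[OF pN_tag])
        show "\<Union>(snd ` pN) \<subseteq> {a..b}" using K_int by (fastforce simp: pN_def)
        have sub: "\<Union>(snd ` pN) \<subseteq> U"
        proof
          fix y assume "y \<in> \<Union>(snd ` pN)"
          then obtain x K where "(x,K) \<in> p" "x \<in> N" "y \<in> K" by (auto simp: pN_def)
          then show "y \<in> U" using fineD[OF finep, of x K] r[of x] by (auto simp: \<gamma>_def)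
        qed
        have "sum (measure lborel) (snd ` pN) = (\<Sum>K\<in>snd ` pN. measure lebesgue K)"
          using div by (intro sum.cong) (auto dest!: division_ofD(4))
        also have "\<dots> = measure lebesgue (\<Union>(snd ` pN))"
          using content_division[OF div] .
        also have "\<dots> \<le> measure lebesgue U"
          using Um sub lmeasurable_division[OF div] by (intro measure_mono_fmeasurable) auto
        finally show "sum (measure lborel) (snd ` pN) < dl" using Udl by simp
      qed
      finally have "norm (sum ?h pN) < e0 / 2" .
      with G show "norm ((\<Sum>(x, k)\<in>p. measure lborel k *\<^sub>R g x) - (f b - f a)) < e0"
        unfolding eq using norm_triangle_ineq[of "sum ?h pN" "sum ?h pG"] by linarith
    qed
  qed
  then show ?thesis
    by (rule has_integral_spike[OF N, rotated]) (auto simp: g_def)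
qed

section \<open>Calibrations and the length of horizontal curves\<close>

lemma has_vector_derivative_compose_real:
  fixes S :: "'a::real_normed_vector \<Rightarrow> real"
  assumes "(f has_vector_derivative v) (at t within T)" and "(S has_derivative S') (at (f t))"
  shows "((\<lambda>t. S (f t)) has_vector_derivative S' v) (at t within T)"
proof -
  have "((\<lambda>t. S (f t)) has_derivative (\<lambda>h. S' (h *\<^sub>R v))) (at t within T)"
    using assms unfolding has_vector_derivative_def
    by (auto intro: has_derivative_compose has_derivative_at_withinI)
  moreover have "S' (h *\<^sub>R v) = h *\<^sub>R S' v" for h
    using has_derivative_linear[OF assms(2)] by (simp add: linear_cmul)
  ultimately show ?thesis by (simp add: has_vector_derivative_def)
qed

lemma horizontal_curve_velocity:
  assumes "horizontal_curve D a b \<sigma>" and "a < b"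
  obtains N where "negligible N"
    and "\<And>t. t \<in> {a..b} - N \<Longrightarrow> vector_derivative \<sigma> (at t within {a..b}) \<in> D (\<sigma> t)"
    and "\<And>t. t \<in> {a..b} - N \<Longrightarrow>
      (\<sigma> has_vector_derivative vector_derivative \<sigma> (at t within {a..b})) (at t within {a..b})"
proof -
  have "AE t in lebesgue. t \<in> {a..b} \<longrightarrow> (\<exists>v \<in> D (\<sigma> t). (\<sigma> has_vector_derivative v) (at t within {a..b}))"
    using assms by (simp add: horizontal_curve_def)
  then obtain N where N: "N \<in> null_sets lebesgue"
    and v: "\<And>t. t \<notin> N \<Longrightarrow> t \<in> {a..b} \<longrightarrow> (\<exists>v \<in> D (\<sigma> t). (\<sigma> has_vector_derivative v) (at t within {a..b}))"
    by (elim AE_E3) auto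
  have "vector_derivative \<sigma> (at t within {a..b}) = v"
    if "(\<sigma> has_vector_derivative v) (at t within {a..b})" "t \<in> {a..b}" for t v
    using vector_derivative_within_cbox[of a b t \<sigma> v] that \<open>a < b\<close> by simp
  with v have "t \<in> {a..b} - N \<Longrightarrow> vector_derivative \<sigma> (at t within {a..b}) \<in> D (\<sigma> t)"
     "t \<in> {a..b} - N \<Longrightarrow>
      (\<sigma> has_vector_derivative vector_derivative \<sigma> (at t within {a..b})) (at t within {a..b})" for t
    by (metis DiffE)+
  with N show ?thesis by (intro that[of N]) (auto simp: negligible_iff_null_sets)
qed

text \<open>
  The calibration principle: a function whose derivative is dominated by the norm of horizontal
  vectors along a curve cannot increase by more than the length of the curve. The velocity is
  taken within the whole interval \<open>{a..b}\<close>, so that the bounds for adjacent pieces of a curve,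
  with different functions \<open>S\<close>, add up to a bound for \<open>sr_length\<close>.
\<close>

lemma calibration_le_length:
  fixes \<sigma> :: "real \<Rightarrow> 'a::euclidean_space" and S :: "'a \<Rightarrow> real"
  assumes hor: "horizontal_curve D a b \<sigma>" and "a < b" "a \<le> s" "s \<le> u" "u \<le> b"
    and lip: "L-lipschitz_on UNIV S"
    and der: "\<And>q. (S has_derivative S' q) (at q)"
    and dom: "\<And>t v. t \<in> {s..u} \<Longrightarrow> v \<in> D (\<sigma> t) \<Longrightarrow> S' (\<sigma> t) v \<le> sqrt (g (\<sigma> t) v v)"
    and g_nonneg: "\<And>q v. 0 \<le> g q v v"
    and meas: "(\<lambda>t. indicator {a..b} t * (let v = vector_derivative \<sigma> (at t within {a..b}) in sqrt (g (\<sigma> t) v v)))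
      \<in> borel_measurable lebesgue"
  shows "ennreal (S (\<sigma> u) - S (\<sigma> s)) \<le>
    (\<integral>\<^sup>+t\<in>{s..u}. ennreal (let v = vector_derivative \<sigma> (at t within {a..b}) in sqrt (g (\<sigma> t) v v)) \<partial>lebesgue)"
proof -
  define vel where "vel t = vector_derivative \<sigma> (at t within {a..b})" for t
  define speed where "speed t = sqrt (g (\<sigma> t) (vel t) (vel t))" for t
  obtain N where N: "negligible N" and velD: "\<And>t. t \<in> {a..b} - N \<Longrightarrow> vel t \<in> D (\<sigma> t)"
    and vel: "\<And>t. t \<in> {a..b} - N \<Longrightarrow> (\<sigma> has_vector_derivative vel t) (at t within {a..b})"
    using horizontal_curve_velocity[OF hor \<open>a < b\<close>] unfolding vel_def by metis
  have sub: "{s..u} \<subseteq> {a..b}" using assms by auto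
  have FTC: "((\<lambda>t. S' (\<sigma> t) (vel t)) has_integral S (\<sigma> u) - S (\<sigma> s)) {s..u}"
  proof (rule fundamental_theorem_of_calculus_absolutely_continuous[OF \<open>s \<le> u\<close> _ N])
    show "absolutely_continuous_curve s u (\<lambda>t. S (\<sigma> t))"
      using hor assms(3,5) lip unfolding horizontal_curve_def
      by (blast intro: absolutely_continuous_curve_lipschitz_comp absolutely_continuous_curve_subinterval)
    fix t assume "t \<in> {s..u} - N"
    then have "(\<sigma> has_vector_derivative vel t) (at t within {s..u})"
      using vel sub by (blast intro: has_vector_derivative_within_subset)
    then show "((\<lambda>t. S (\<sigma> t)) has_vector_derivative S' (\<sigma> t) (vel t)) (at t within {s..u})"
      by (rule has_vector_derivative_compose_real[OF _ der])
  qed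
  let ?I = "\<integral>\<^sup>+t\<in>{s..u}. ennreal (speed t) \<partial>lebesgue"
  have speed0: "speed t \<ge> 0" for t by (simp add: speed_def g_nonneg)
  have "ennreal (S (\<sigma> u) - S (\<sigma> s)) \<le> ?I"
  proof (cases "?I = \<infinity>")
    case False
    define h where "h t = indicator {s..u} t * speed t" for t
    have h_eq: "h = (\<lambda>t. indicator {s..u} t * (indicator {a..b} t * speed t))"
      using sub by (auto simp: h_def indicator_def fun_eq_iff)
    have hm: "h \<in> borel_measurable lebesgue"
      unfolding h_eq
    proof (rule borel_measurable_times)
      show "indicator {s..u} \<in> borel_measurable lebesgue"
        by (intro borel_measurable_indicator) auto
      show "(\<lambda>t. indicator {a..b} t * speed t) \<in> borel_measurable lebesgue"
        using meas by (simp add: speed_def vel_def Let_def)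
    qed
    have h0: "h t \<ge> 0" for t by (simp add: h_def speed0)
    have "integral\<^sup>N lebesgue h = ?I"
      by (intro nn_integral_cong) (auto simp: h_def indicator_def)
    moreover have "?I = ennreal (enn2real ?I)" using False by (simp add: less_top)
    ultimately have "(h has_integral enn2real ?I) UNIV"
      using has_integral_iff_nn_integral_lebesgue[of h "enn2real ?I"] h0 hm by simp
    moreover have "h = (\<lambda>t. if t \<in> {s..u} then speed t else 0)"
      by (auto simp: h_def fun_eq_iff)
    ultimately have hI: "(speed has_integral enn2real ?I) {s..u}"
      using has_integral_restrict_UNIV[of "{s..u}" speed] by simp
    have "((\<lambda>t. if t \<in> N then speed t else S' (\<sigma> t) (vel t)) has_integral S (\<sigma> u) - S (\<sigma> s)) {s..u}"
      by (rule has_integral_spike[OF N _ FTC]) auto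
    then have "S (\<sigma> u) - S (\<sigma> s) \<le> enn2real ?I"
      using hI
    proof (rule has_integral_le)
      fix t assume "t \<in> {s..u}"
      then show "(if t \<in> N then speed t else S' (\<sigma> t) (vel t)) \<le> speed t"
        using dom[of t "vel t"] velD[of t] sub by (auto simp: speed_def)
    qed
    then have "ennreal (S (\<sigma> u) - S (\<sigma> s)) \<le> ennreal (enn2real ?I)" by (rule ennreal_leI)
    with \<open>?I = ennreal (enn2real ?I)\<close> show ?thesis by simp
  qed simp
  then show ?thesis by (simp add: speed_def vel_def Let_def)
qed

text \<open>
  The velocity is integrable by the fundamental theorem of calculus, hence measurable; this is
  needed because \<open>sr_length\<close> is a Lebesgue integral.
\<close>

lemma magnetic_speed_measurable:
  assumes hor: "horizontal_curve D a b \<sigma>" and "a < b"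
  shows "(\<lambda>t. indicator {a..b} t *
      (let v = vector_derivative \<sigma> (at t within {a..b}) in sqrt (magnetic_metric (\<sigma> t) v v)))
    \<in> borel_measurable lebesgue"
proof -
  obtain N where N: "negligible N" 
    and vel: "\<And>t. t \<in> {a..b} - N \<Longrightarrow>
      (\<sigma> has_vector_derivative vector_derivative \<sigma> (at t within {a..b})) (at t within {a..b})"
    using horizontal_curve_velocity[OF assms] by metis
  let ?v = "\<lambda>t. vector_derivative \<sigma> (at t within {a..b})"
  have "(?v has_integral \<sigma> b - \<sigma> a) {a..b}"
    using hor \<open>a < b\<close> by (intro fundamental_theorem_of_calculus_absolutely_continuous[OF _ _ N vel])
      (auto simp: horizontal_curve_def)
  then have "(\<lambda>t. indicator {a..b} t *\<^sub>R ?v t) \<in> borel_measurable lebesgue"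
    by (rule has_integral_implies_lebesgue_measurable)
  then have "(\<lambda>t. sqrt ((fst (indicator {a..b} t *\<^sub>R ?v t))\<^sup>2 + (fst (snd (indicator {a..b} t *\<^sub>R ?v t)))\<^sup>2))
    \<in> borel_measurable lebesgue"
    by (rule borel_measurable_continuous_on[rotated]) (intro continuous_intros)
  also have "(\<lambda>t. sqrt ((fst (indicator {a..b} t *\<^sub>R ?v t))\<^sup>2 + (fst (snd (indicator {a..b} t *\<^sub>R ?v t)))\<^sup>2))
    = (\<lambda>t. indicator {a..b} t * (let v = ?v t in sqrt (magnetic_metric (\<sigma> t) v v)))"
    by (auto simp: fun_eq_iff magnetic_metric_def indicator_def split_def Let_def power2_eq_square)
  finally show ?thesis .
qed

lemma sr_length_split:
  assumes hor: "horizontal_curve D a b \<sigma>" and "a < b" and s: "a \<le> s" "s \<le> b"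
  shows "sr_length magnetic_metric a b \<sigma> =
    (\<integral>\<^sup>+t\<in>{a..s}. ennreal (let v = vector_derivative \<sigma> (at t within {a..b}) in sqrt (magnetic_metric (\<sigma> t) v v)) \<partial>lebesgue) +
    (\<integral>\<^sup>+t\<in>{s..b}. ennreal (let v = vector_derivative \<sigma> (at t within {a..b}) in sqrt (magnetic_metric (\<sigma> t) v v)) \<partial>lebesgue)"
proof -
  define w where "w t = (let v = vector_derivative \<sigma> (at t within {a..b}) in sqrt (magnetic_metric (\<sigma> t) v v))" for t
  define W where "W t = ennreal (indicator {a..b} t * w t)" for t
  have "(\<lambda>t. indicator {a..b} t * w t) \<in> borel_measurable lebesgue"
    using magnetic_speed_measurable[OF hor \<open>a < b\<close>] unfolding w_def .
  then have W: "W \<in> borel_measurable lebesgue"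
    unfolding W_def by (rule measurable_compose[OF _ measurable_ennreal])
  have "(\<integral>\<^sup>+t\<in>{a..b}. ennreal (w t) \<partial>lebesgue) = (\<integral>\<^sup>+t\<in>{a..s} \<union> {s<..b}. W t \<partial>lebesgue)"
    using s by (intro nn_integral_cong) (auto simp: W_def indicator_def)
  also have "\<dots> = (\<integral>\<^sup>+t\<in>{a..s}. W t \<partial>lebesgue) + (\<integral>\<^sup>+t\<in>{s<..b}. W t \<partial>lebesgue)"
    using W by (intro nn_integral_disjoint_pair) auto
  also have "(\<integral>\<^sup>+t\<in>{s<..b}. W t \<partial>lebesgue) = (\<integral>\<^sup>+t\<in>{s..b}. W t \<partial>lebesgue)"
  proof (rule nn_integral_cong_AE)
    have "{s} \<in> null_sets lebesgue" by (simp flip: negligible_iff_null_sets)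
    then have "AE t in lebesgue. t \<notin> {s}" by (rule AE_not_in)
    then show "AE t in lebesgue. W t * indicator {s<..b} t = W t * indicator {s..b} t"
      by eventually_elim (auto simp: indicator_def)
  qed
  also have "(\<integral>\<^sup>+t\<in>{a..s}. W t \<partial>lebesgue) = (\<integral>\<^sup>+t\<in>{a..s}. ennreal (w t) \<partial>lebesgue)"
    using s by (intro nn_integral_cong) (auto simp: W_def indicator_def)
  also have "(\<integral>\<^sup>+t\<in>{s..b}. W t \<partial>lebesgue) = (\<integral>\<^sup>+t\<in>{s..b}. ennreal (w t) \<partial>lebesgue)"
    using s by (intro nn_integral_cong) (auto simp: W_def indicator_def)
  finally show ?thesis by (simp add: sr_length_def w_def)
qed

section \<open>Calibrations of the magnetic space\<close>

text \<open>
  \<open>arc_slope n\<close> is the momentum \<open>sqrt (1 - F\<^sup>2)\<close> on the energy level for \<open>F s = 1 - 2 * s ^ (2 * n)\<close>,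
  the profile scaled to the hill interval \<open>{0..1}\<close>. The truncation by \<open>max\<close> makes it continuous on
  the whole line, so that its antiderivative is defined and Lipschitz everywhere.
\<close>

definition arc_slope :: "nat \<Rightarrow> real \<Rightarrow> real" where
  "arc_slope n s = sqrt (max 0 (1 - (1 - 2 * s ^ (2 * n))\<^sup>2))"

definition arc_integral :: "nat \<Rightarrow> real \<Rightarrow> real" where
  "arc_integral n = (SOME k. k 0 = 0 \<and> (\<forall>s. (k has_real_derivative arc_slope n s) (at s)))"

text \<open>
  The function \<open>K\<^sub>M\<close>: the action coordinate of the profile scaled to the hill interval \<open>{0..M}\<close>.
\<close>

definition well_potential :: "nat \<Rightarrow> real \<Rightarrow> real \<Rightarrow> real" where
  "well_potential n M x = M * arc_integral n (x / M)"

lemma arc_integral: "arc_integral n 0 = 0" "(arc_integral n has_real_derivative arc_slope n s) (at s)"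
proof -
  have "isCont (arc_slope n) x" for x
    unfolding arc_slope_def by (intro continuous_intros)
  then obtain K where K: "\<And>x. (K has_vector_derivative arc_slope n x) (at x)"
    using einterval_antiderivative[of "-\<infinity>" "\<infinity>" "arc_slope n"] by auto
  then have "\<exists>k. k 0 = 0 \<and> (\<forall>s. (k has_real_derivative arc_slope n s) (at s))"
    by (intro exI[of _ "\<lambda>s. K s - K 0"])
      (auto simp: has_real_derivative_iff_has_vector_derivative intro!: derivative_eq_intros)
  from someI_ex[OF this] show "arc_integral n 0 = 0" "(arc_integral n has_real_derivative arc_slope n s) (at s)"
    by (simp_all add: arc_integral_def)
qed

lemma arc_slope_bounds: "0 \<le> arc_slope n s" "arc_slope n s \<le> 1"
  by (auto simp: arc_slope_def)

lemma arc_slope_power2: "\<bar>s\<bar> \<le> 1 \<Longrightarrow> (arc_slope n s)\<^sup>2 = 1 - (1 - 2 * s ^ (2 * n))\<^sup>2"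
proof -
  assume "\<bar>s\<bar> \<le> 1"
  then have "0 \<le> s ^ (2*n)" "s ^ (2*n) \<le> 1"
    using power_le_one[of "\<bar>s\<bar>" "2*n"] by (auto simp: power_even_abs zero_le_power_eq)
  then have "\<bar>1 - 2 * s ^ (2*n)\<bar> \<le> 1" by (simp add: abs_le_iff)
  then have "(1 - 2 * s ^ (2*n))\<^sup>2 \<le> 1" by (simp add: abs_square_le_1)
  then show ?thesis by (simp add: arc_slope_def)
qed

lemma arc_integral_minus: "arc_integral n (- s) = - arc_integral n s"
proof -
  have "((\<lambda>s. arc_integral n (- s) + arc_integral n s) has_real_derivative 0) (at s)" for s
  proof -
    have "((\<lambda>s. arc_integral n (- s)) has_real_derivative arc_slope n (-s) * (-1)) (at s)"
      by (rule DERIV_chain2[OF arc_integral(2)]) (auto intro!: derivative_eq_intros)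
    from DERIV_add[OF this arc_integral(2)[of n s]] show ?thesis
      by (simp add: arc_slope_def)
  qed
  then have "arc_integral n (- s) + arc_integral n s = arc_integral n (- 0) + arc_integral n 0"
    using DERIV_isconst_all[of "\<lambda>s. arc_integral n (- s) + arc_integral n s" s 0] by blast
  then show ?thesis by (simp add: arc_integral)
qed

lemma well_potential_deriv:
  assumes "M > 0"
  shows "(well_potential n M has_real_derivative arc_slope n (x / M)) (at x)"
proof -
  have "((\<lambda>x. arc_integral n (x / M)) has_real_derivative arc_slope n (x / M) * (1 / M)) (at x)"
    by (rule DERIV_chain2[OF arc_integral(2)]) (use assms in \<open>auto intro!: derivative_eq_intros\<close>)
  from DERIV_cmult[OF this, of M] have "(well_potential n M has_real_derivative M * (arc_slope n (x / M) * (1 / M))) (at x)"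
    by (simp only: well_potential_def[abs_def])
  then show ?thesis using assms by simp
qed

lemma well_potential_minus: "well_potential n M (- x) = - well_potential n M x"
  by (simp add: well_potential_def arc_integral_minus)

lemma well_potential_0: "well_potential n M 0 = 0"
  by (simp add: well_potential_def arc_integral)

lemma well_potential_mono:
  assumes "M > 0" "x \<le> y"
  shows "well_potential n M x \<le> well_potential n M y"
  using DERIV_nonneg_imp_nondecreasing[OF assms(2), of "well_potential n M"]
    well_potential_deriv[OF assms(1)] arc_slope_bounds by blast

lemma well_potential_lipschitz:
  assumes "M > 0"
  shows "\<bar>well_potential n M x - well_potential n M y\<bar> \<le> \<bar>x - y\<bar>"
proof -
  have "1-lipschitz_on UNIV (well_potential n M)"
    by (rule bounded_derivative_imp_lipschitz[where f'="\<lambda>x h. arc_slope n (x / M) * h"])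
      (use well_potential_deriv[OF assms] arc_slope_bounds in
        \<open>auto simp: has_field_derivative_def has_derivative_at_withinI intro!: onorm_le simp: abs_mult mult_left_le_one_le\<close>)
  from lipschitz_onD[OF this, of x y] show ?thesis by (simp add: dist_real_def)
qed

text \<open>
  The coefficient \<open>\<mu>\<close> for which \<open>1 + \<mu> * b * x ^ (2 * n)\<close> is the profile with hill interval \<open>{0..M}\<close>.
\<close>

definition calibration_multiplier :: "nat \<Rightarrow> real \<Rightarrow> real \<Rightarrow> real" where
  "calibration_multiplier n b M = - 2 / (b * M ^ (2 * n))"

lemma multiplier_F:
  "b > 0 \<Longrightarrow> M > 0 \<Longrightarrow>
    1 + calibration_multiplier n b M * (b * x ^ (2 * n)) = 1 - 2 * (x / M) ^ (2 * n)"
  by (simp add: calibration_multiplier_def power_divide field_simps)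

text \<open>
  Along horizontal vectors \<open>dz = F dy\<close>, so the first two terms have differential \<open>\<epsilon> * F\<^sub>M dy\<close> with
  \<open>F\<^sub>M x = 1 - 2 * (x / M) ^ (2 * n)\<close>, and the third has differential \<open>\<tau> * sqrt (1 - F\<^sub>M\<^sup>2) dx\<close>:
  the horizontal gradient is a unit vector wherever \<open>\<bar>x\<bar> \<le> M\<close>.
\<close>

definition magnetic_calibration :: "nat \<Rightarrow> real \<Rightarrow> real \<Rightarrow> real \<Rightarrow> real \<Rightarrow> real \<times> real \<times> real \<Rightarrow> real" where
  "magnetic_calibration n b \<epsilon> M \<tau> = (\<lambda>(x, y, z).
     (1 + calibration_multiplier n b M) * (\<epsilon> * y) - calibration_multiplier n b M * z
       + \<tau> * well_potential n M x)"

lemma unit_vector_inner_le_norm: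
  fixes A B u v :: real
  assumes "A\<^sup>2 + B\<^sup>2 = 1"
  shows "A * u + B * v \<le> sqrt (u\<^sup>2 + v\<^sup>2)"
proof (rule real_le_rsqrt)
  have "u\<^sup>2 + v\<^sup>2 - (A * u + B * v)\<^sup>2 = (A * v - B * u)\<^sup>2"
    using assms by algebra
  then show "(A * u + B * v)\<^sup>2 \<le> u\<^sup>2 + v\<^sup>2" by (metis diff_ge_0_iff_ge zero_le_power2)
qed

lemma magnetic_calibration_le_length:
  assumes hor: "horizontal_curve (magnetic_distribution F) a c \<sigma>" and ord: "a < c" "a \<le> s" "s \<le> u" "u \<le> c"
    and F: "\<And>x. poly F x = \<epsilon> * (1 - b * x ^ (2 * n))"
    and b: "b > 0" and M: "M > 0" and \<epsilon>: "\<epsilon>\<^sup>2 = 1" and \<tau>: "\<tau>\<^sup>2 = 1"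
    and le_M: "\<And>t. t \<in> {s..u} \<Longrightarrow> \<bar>fst (\<sigma> t)\<bar> \<le> M"
  shows "ennreal (magnetic_calibration n b \<epsilon> M \<tau> (\<sigma> u) - magnetic_calibration n b \<epsilon> M \<tau> (\<sigma> s)) \<le>
    (\<integral>\<^sup>+t\<in>{s..u}. ennreal (let v = vector_derivative \<sigma> (at t within {a..c}) in
       sqrt (magnetic_metric (\<sigma> t) v v)) \<partial>lebesgue)"
proof -
  let ?m = "calibration_multiplier n b M"
  let ?S = "magnetic_calibration n b \<epsilon> M \<tau>"
  let ?L = "\<bar>1 + ?m\<bar> + \<bar>?m\<bar> + 1"
  let ?S' = "\<lambda>q v. (1 + ?m) * (\<epsilon> * fst (snd v)) - ?m * snd (snd v)
      + \<tau> * (arc_slope n (fst q / M) * fst v)"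
  have S_eq: "?S = (\<lambda>q. (1 + ?m) * (\<epsilon> * fst (snd q)) - ?m * snd (snd q) + \<tau> * well_potential n M (fst q))"
    by (auto simp: magnetic_calibration_def fun_eq_iff)
  have abs_\<epsilon>: "\<bar>\<epsilon>\<bar> = 1" and abs_\<tau>: "\<bar>\<tau>\<bar> = 1"
    using \<epsilon> \<tau> by (auto simp: power2_eq_1_iff)
  show ?thesis
  proof (rule calibration_le_length[OF hor ord, where L = ?L and S = ?S and S' = ?S'])
    show "?L-lipschitz_on UNIV ?S"
    proof (rule lipschitz_onI)
      fix p q :: "real \<times> real \<times> real"
      have d: "\<bar>fst p - fst q\<bar> \<le> dist p q" "\<bar>fst (snd p) - fst (snd q)\<bar> \<le> dist p q"
        "\<bar>snd (snd p) - snd (snd q)\<bar> \<le> dist p q"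
        using dist_fst_le[of p q] dist_snd_le[of p q] dist_fst_le[of "snd p" "snd q"]
          dist_snd_le[of "snd p" "snd q"] by (auto simp: dist_real_def)
      have "?S p - ?S q = (1 + ?m) * (\<epsilon> * (fst (snd p) - fst (snd q))) - ?m * (snd (snd p) - snd (snd q))
          + \<tau> * (well_potential n M (fst p) - well_potential n M (fst q))"
        by (simp add: S_eq algebra_simps)
      also have "\<bar>\<dots>\<bar> \<le> \<bar>1 + ?m\<bar> * \<bar>fst (snd p) - fst (snd q)\<bar> + \<bar>?m\<bar> * \<bar>snd (snd p) - snd (snd q)\<bar>
          + \<bar>well_potential n M (fst p) - well_potential n M (fst q)\<bar>"
        by (intro order_trans[OF abs_triangle_ineq] order_trans[OF abs_triangle_ineq4] add_mono)
          (simp_all add: abs_mult abs_\<epsilon> abs_\<tau>)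
      also have "\<dots> \<le> \<bar>1 + ?m\<bar> * dist p q + \<bar>?m\<bar> * dist p q + dist p q"
        using d well_potential_lipschitz[OF M, of n "fst p" "fst q"]
        by (intro add_mono mult_left_mono) auto
      finally show "dist (?S p) (?S q) \<le> ?L * dist p q"
        by (simp add: dist_real_def algebra_simps)
    qed simp
  next
    fix q :: "real \<times> real \<times> real"
    have "(well_potential n M has_derivative (\<lambda>h. arc_slope n (fst q / M) * h)) (at (fst q))"
      using well_potential_deriv[OF M] by (simp add: has_field_derivative_def)
    then have "((\<lambda>q. well_potential n M (fst q)) has_derivative (\<lambda>v. arc_slope n (fst q / M) * fst v)) (at q)"
      by (rule has_derivative_compose[rotated]) (auto intro!: derivative_eq_intros)
    then show "(?S has_derivative ?S' q) (at q)"
      unfolding S_eq by (auto intro!: derivative_eq_intros)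
  next
    fix t v assume t: "t \<in> {s..u}" and v: "v \<in> magnetic_distribution F (\<sigma> t)"
    let ?x = "fst (\<sigma> t)"
    let ?f = "1 - 2 * (?x / M) ^ (2 * n)" and ?r = "arc_slope n (?x / M)"
    have dz: "snd (snd v) = \<epsilon> * (1 - b * ?x ^ (2 * n)) * fst (snd v)"
      using v F by (auto simp: magnetic_distribution_def split_def)
    have "?S' (\<sigma> t) v = (\<epsilon> * (1 + ?m * (b * ?x ^ (2 * n)))) * fst (snd v) + (\<tau> * ?r) * fst v"
      unfolding dz by (simp add: algebra_simps)
    also have "\<dots> = (\<epsilon> * ?f) * fst (snd v) + (\<tau> * ?r) * fst v"
      unfolding multiplier_F[OF b M] ..
    also have "\<dots> \<le> sqrt ((fst (snd v))\<^sup>2 + (fst v)\<^sup>2)"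
    proof (rule unit_vector_inner_le_norm)
      have "\<bar>?x / M\<bar> \<le> 1" using le_M[OF t] M by simp
      from arc_slope_power2[OF this] show "(\<epsilon> * ?f)\<^sup>2 + (\<tau> * ?r)\<^sup>2 = 1"
        by (simp add: power_mult_distrib \<epsilon> \<tau>)
    qed
    also have "\<dots> = sqrt (magnetic_metric (\<sigma> t) v v)"
      by (simp add: magnetic_metric_def split_def power2_eq_square add.commute)
    finally show "?S' (\<sigma> t) v \<le> sqrt (magnetic_metric (\<sigma> t) v v)" .
  next
    show "0 \<le> magnetic_metric q v v" for q v :: "real \<times> real \<times> real"
      by (simp add: magnetic_metric_def split_def)
  qed (rule magnetic_speed_measurable[OF hor ord(1)])
qed

section \<open>The homoclinic loop\<close>

lemma unit_vectors_inner_le_1: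
  fixes a f r p :: real
  assumes "p\<^sup>2 + a\<^sup>2 = 1" "r\<^sup>2 + f\<^sup>2 = 1"
  shows "a * f + r * p \<le> 1"
proof -
  have "2 - 2 * (a * f + r * p) = (a - f)\<^sup>2 + (r - p)\<^sup>2"
    using assms by algebra
  also have "\<dots> \<ge> 0" by simp
  finally show ?thesis by simp
qed

lemma DERIV_zero_imp_eq:
  fixes f :: "real \<Rightarrow> real"
  assumes "s \<le> u" "\<And>t. s \<le> t \<Longrightarrow> t \<le> u \<Longrightarrow> (f has_real_derivative 0) (at t)"
  shows "f u = f s"
proof (rule antisym)
  show "f u \<le> f s" by (rule DERIV_nonpos_imp_nonincreasing[OF assms(1)]) (use assms in force)
  show "f s \<le> f u" by (rule DERIV_nonneg_imp_nondecreasing[OF assms(1)]) (use assms in force)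
qed

text \<open>
  The homoclinic geodesic after reflections: \<open>X\<close> is \<open>\<bar>x\<bar>\<close>, \<open>P\<close> its momentum, \<open>Y\<close> is \<open>y\<close> up to the sign of
  the polynomial, and \<open>Z\<close> is \<open>z\<close>.
\<close>

locale homoclinic_well =
  fixes n :: nat and b :: real and X P Y Z :: "real \<Rightarrow> real"
  assumes n: "n \<ge> 1" and b: "b > 0"
    and X_deriv: "\<And>t. (X has_real_derivative P t) (at t)"
    and P_deriv: "\<And>t. (P has_real_derivative 2 * n * b * X t ^ (2 * n - 1) * (1 - b * X t ^ (2 * n))) (at t)"
    and energy: "\<And>t. (P t)\<^sup>2 + (1 - b * X t ^ (2 * n))\<^sup>2 = 1"
    and X_pos: "\<And>t. X t > 0"
    and X_top: "(X \<longlongrightarrow> 0) at_top" and X_bot: "(X \<longlongrightarrow> 0) at_bot"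
    and Y_deriv: "\<And>t. (Y has_real_derivative 1 - b * X t ^ (2 * n)) (at t)"
    and Z_deriv: "\<And>t. (Z has_real_derivative (1 - b * X t ^ (2 * n))\<^sup>2) (at t)"
begin

abbreviation G where "G t \<equiv> b * X t ^ (2 * n)"

lemma G_bounds: "0 < G t" "G t \<le> 2"
proof -
  show "0 < G t" using b X_pos by simp
  have "(1 - G t)\<^sup>2 \<le> 1" by (metis energy le_add_same_cancel2 zero_le_power2)
  then have "\<bar>1 - G t\<bar> \<le> 1" by (simp add: abs_square_le_1)
  then show "G t \<le> 2" by linarith
qed

lemma P_power2: "(P t)\<^sup>2 = G t * (2 - G t)"
  using energy[of t] by (simp add: power2_eq_square algebra_simps)

lemma P_abs_le: "\<bar>P t\<bar> \<le> 1"
proof -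
  have "(P t)\<^sup>2 \<le> 1" by (metis energy le_add_same_cancel1 zero_le_power2)
  then show ?thesis by (simp add: abs_square_le_1)
qed

lemma X_P_deriv: "X t * (2 * n * b * X t ^ (2 * n - 1) * (1 - G t)) = 2 * n * G t * (1 - G t)"
proof -
  have "X t * X t ^ (2 * n - 1) = X t ^ (2 * n)"
    using n by (metis power_eq_if mult_eq_0_iff not_one_le_zero zero_neq_numeral)
  then show ?thesis by (simp add: ac_simps)
qed

text \<open>
  By conservation of energy the derivative of \<open>P / X ^ n\<close> is \<open>- n * G\<^sup>2 / X ^ (n + 1)\<close>. The exponent \<open>n\<close> is
  the one for which the terms linear in \<open>G\<close> cancel. The sign of \<open>P\<close> therefore changes at most once.
\<close>

lemma momentum_quotient_antitone:
  assumes "s \<le> t"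
  shows "P t / X t ^ n \<le> P s / X s ^ n"
proof (rule DERIV_nonpos_imp_nonincreasing[OF assms])
  fix t
  let ?P' = "2 * n * b * X t ^ (2 * n - 1) * (1 - G t)"
  let ?d = "(?P' * X t ^ n - P t * (n * X t ^ (n - 1) * P t)) / (X t ^ n * X t ^ n)"
  have "((\<lambda>t. P t / X t ^ n) has_real_derivative ?d) (at t)"
    using X_pos[of t] P_deriv[of t] X_deriv[of t]
    by (auto intro!: derivative_eq_intros simp: ac_simps)
  moreover have "?d \<le> 0"
  proof -
    have Xn: "X t ^ (n - 1) * X t = X t ^ n"
      using n by (metis power_minus_mult less_le_trans zero_less_one)
    have "X t * (?P' * X t ^ n - P t * (n * X t ^ (n - 1) * P t))
      = (X t * ?P') * X t ^ n - n * (P t)\<^sup>2 * (X t ^ (n - 1) * X t)"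
      by (simp add: power2_eq_square algebra_simps)
    also have "\<dots> = - (n * X t ^ n * (G t)\<^sup>2)"
      unfolding X_P_deriv P_power2 Xn by (simp add: power2_eq_square algebra_simps)
    also have "\<dots> \<le> 0" using X_pos[of t] by simp
    finally have "?P' * X t ^ n - P t * (n * X t ^ (n - 1) * P t) \<le> 0"
      using X_pos[of t] by (meson mult_pos_pos not_le)
    then show ?thesis using X_pos[of t] by (simp add: divide_nonpos_pos)
  qed
  ultimately show "\<exists>y. ((\<lambda>t. P t / X t ^ n) has_real_derivative y) (at t) \<and> y \<le> 0" by blast
qed

lemma turning_time:
  obtains t0 where "P t0 = 0" "\<And>t. t \<le> t0 \<Longrightarrow> 0 \<le> P t" "\<And>t. t0 \<le> t \<Longrightarrow> P t \<le> 0"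
proof -
  have contX: "continuous_on A X" for A
    using X_deriv by (meson DERIV_atLeastAtMost_imp_continuous_on DERIV_isCont continuous_at_imp_continuous_on)
  have "eventually (\<lambda>t. X t < X 0) at_top" "eventually (\<lambda>t. X t < X 0) at_bot"
    using order_tendstoD(2)[OF X_top X_pos] order_tendstoD(2)[OF X_bot X_pos] by auto
  then obtain T1 T2 where T: "\<And>t. t \<ge> T1 \<Longrightarrow> X t < X 0" "\<And>t. t \<le> T2 \<Longrightarrow> X t < X 0"
    by (auto simp: eventually_at_top_linorder eventually_at_bot_linorder)
  have T0: "T2 \<le> 0" "0 \<le> T1" using T(1)[of 0] T(2)[of 0] by (meson less_irrefl linear)+
  then obtain t0 where t0: "t0 \<in> {T2..T1}" "\<And>t. t \<in> {T2..T1} \<Longrightarrow> X t \<le> X t0"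
    using continuous_attains_sup[OF compact_Icc _ contX, of T2 T1] by force
  have "X t \<le> X t0" for t
    using t0(2)[of t] T(1)[of t] T(2)[of t] t0(2)[of 0] T0 by fastforce
  then have P0: "P t0 = 0"
    by (intro DERIV_local_max[OF X_deriv, of 1]) auto
  show ?thesis
  proof (rule that[OF P0])
    fix t assume "t \<le> t0"
    then show "0 \<le> P t" using momentum_quotient_antitone[of t t0] P0 zero_less_power[OF X_pos[of t], of n]
      by (simp add: zero_le_divide_iff)
  next
    fix t assume "t0 \<le> t"
    then show "P t \<le> 0" using momentum_quotient_antitone[of t0 t] P0 zero_less_power[OF X_pos[of t], of n]
      by (simp add: divide_le_0_iff)
  qed
qed

text \<open>
  The time at which the geodesic turns back at the outer end of the hill interval.
\<close>

definition t0 where "t0 = (SOME t0. P t0 = 0 \<and> (\<forall>t\<le>t0. 0 \<le> P t) \<and> (\<forall>t\<ge>t0. P t \<le> 0))"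

lemma t0: "P t0 = 0" "t \<le> t0 \<Longrightarrow> 0 \<le> P t" "t0 \<le> t \<Longrightarrow> P t \<le> 0"
proof -
  have "\<exists>t0. P t0 = 0 \<and> (\<forall>t\<le>t0. 0 \<le> P t) \<and> (\<forall>t\<ge>t0. P t \<le> 0)"
    using turning_time by metis
  from someI_ex[OF this, folded t0_def]
  show "P t0 = 0" "t \<le> t0 \<Longrightarrow> 0 \<le> P t" "t0 \<le> t \<Longrightarrow> P t \<le> 0" by auto
qed

definition width where "width = X t0"

lemma width_pos: "width > 0" by (simp add: width_def X_pos)

lemma width_power: "b * width ^ (2 * n) = 2"
proof -
  have "G t0 * (2 - G t0) = 0" using P_power2[of t0] t0(1) by simp
  moreover have "G t0 \<noteq> 0" using G_bounds(1)[of t0] by linarith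
  ultimately have "2 - G t0 = 0" using mult_eq_0_iff by blast
  then show ?thesis by (simp add: width_def)
qed

lemma X_le_width: "X t \<le> width"
proof -
  have "b * X t ^ (2*n) \<le> b * width ^ (2*n)" using G_bounds(2)[of t] width_power by simp
  then have "X t ^ (2*n) \<le> width ^ (2*n)" using b by simp
  then show ?thesis using n width_pos X_pos[of t] by (subst (asm) power_mono_iff) auto
qed

lemma X_mono: "s \<le> t \<Longrightarrow> t \<le> t0 \<Longrightarrow> X s \<le> X t"
  by (rule DERIV_nonneg_imp_nondecreasing[of s t X]) (use X_deriv t0(2) in \<open>blast intro: order_trans\<close>)+

lemma X_antimono: "t0 \<le> s \<Longrightarrow> s \<le> t \<Longrightarrow> X t \<le> X s"
  by (rule DERIV_nonpos_imp_nonincreasing[of s t X]) (use X_deriv t0(3) in \<open>blast intro: order_trans\<close>)+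

abbreviation multiplier where "multiplier \<equiv> calibration_multiplier n b"

text \<open>
  Suppose that a competitor from the point at time \<open>s\<close> to the point at time \<open>u\<close> has maximal \<open>\<bar>x\<bar>\<close> equal
  to \<open>M\<close>. Calibrating it with \<open>K\<^sub>M\<close> up to the maximum and with \<open>- K\<^sub>M\<close> afterwards bounds its length
  from below; \<open>excess\<close> is this bound minus the length \<open>u - s\<close> of the geodesic.
\<close>

definition excess where
  "excess M s u = ((1 + multiplier M) * (Y u - Y s) - multiplier M * (Z u - Z s)
      + 2 * well_potential n M M - well_potential n M (X s) - well_potential n M (X u)) - (u - s)"

lemma calibration_deriv:
  "((\<lambda>t. (1 + multiplier M) * Y t - multiplier M * Z t - t) has_real_derivative
      (1 - G t) * (1 + multiplier M * G t) - 1) (at t)"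
  by (rule derivative_eq_intros Y_deriv Z_deriv refl | simp add: power2_eq_square algebra_simps)+

lemma X_potential_deriv:
  "M > 0 \<Longrightarrow> ((\<lambda>t. well_potential n M (X t)) has_real_derivative arc_slope n (X t / M) * P t) (at t)"
  by (rule DERIV_chain2[OF well_potential_deriv X_deriv])

text \<open>
  The velocity \<open>(1 - G, P)\<close> of the geodesic and the gradient \<open>(F\<^sub>M, \<plusminus> sqrt (1 - F\<^sub>M\<^sup>2))\<close> of the
  calibration are unit vectors, so this is the Cauchy-Schwarz inequality; the absolute value covers
  both signs.
\<close>

lemma excess_rate_nonpos:
  assumes "M > 0" "X t \<le> M"
  shows "(1 - G t) * (1 + multiplier M * G t) - 1 + \<bar>arc_slope n (X t / M) * P t\<bar> \<le> 0"
proof -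
  let ?f = "1 + multiplier M * G t" and ?r = "arc_slope n (X t / M)"
  have "\<bar>X t / M\<bar> \<le> 1" using assms X_pos[of t] by simp
  then have r2: "?r\<^sup>2 = 1 - ?f\<^sup>2"
    using arc_slope_power2 multiplier_F[OF b assms(1)] by simp
  have "(1 - G t) * ?f + ?r * \<bar>P t\<bar> \<le> 1"
    by (rule unit_vectors_inner_le_1) (use r2 energy[of t] in auto)
  then show ?thesis by (simp add: abs_mult arc_slope_bounds)
qed

text \<open>
  Lengthening the geodesic segment can only lower the excess, since the added pieces are compared
  with a calibration that they need not follow.
\<close>

lemma excess_antimono:
  assumes M: "M > 0" and "s' \<le> s" "u \<le> u'"
    and tail: "\<And>t. t \<le> s \<Longrightarrow> X t \<le> M" "\<And>t. u \<le> t \<Longrightarrow> X t \<le> M"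
  shows "excess M s' u' \<le> excess M s u"
proof -
  let ?\<phi> = "\<lambda>t. (1 + multiplier M) * Y t - multiplier M * Z t - t"
  let ?K = "\<lambda>t. well_potential n M (X t)"
  have "?\<phi> u' - ?K u' \<le> ?\<phi> u - ?K u"
  proof (rule DERIV_nonpos_imp_nonincreasing[OF \<open>u \<le> u'\<close>])
    fix t assume t: "u \<le> t"
    have "((\<lambda>t. ?\<phi> t - ?K t) has_real_derivative
        ((1 - G t) * (1 + multiplier M * G t) - 1) - arc_slope n (X t / M) * P t) (at t)"
      by (rule DERIV_diff[OF calibration_deriv X_potential_deriv[OF M]])
    moreover have "((1 - G t) * (1 + multiplier M * G t) - 1) - arc_slope n (X t / M) * P t \<le> 0"
      using excess_rate_nonpos[OF M tail(2)[OF t]] by linarith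
    ultimately show "\<exists>y. ((\<lambda>t. ?\<phi> t - ?K t) has_real_derivative y) (at t) \<and> y \<le> 0" by blast
  qed
  moreover have "?\<phi> s + ?K s \<le> ?\<phi> s' + ?K s'"
  proof (rule DERIV_nonpos_imp_nonincreasing[OF \<open>s' \<le> s\<close>])
    fix t assume t: "t \<le> s"
    have "((\<lambda>t. ?\<phi> t + ?K t) has_real_derivative
        ((1 - G t) * (1 + multiplier M * G t) - 1) + arc_slope n (X t / M) * P t) (at t)"
      by (rule DERIV_add[OF calibration_deriv X_potential_deriv[OF M]])
    moreover have "((1 - G t) * (1 + multiplier M * G t) - 1) + arc_slope n (X t / M) * P t \<le> 0"
      using excess_rate_nonpos[OF M tail(1)[OF t]] by linarith
    ultimately show "\<exists>y. ((\<lambda>t. ?\<phi> t + ?K t) has_real_derivative y) (at t) \<and> y \<le> 0" by blast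
  qed
  ultimately show ?thesis by (simp add: excess_def algebra_simps)
qed

text \<open>
  The derivative of \<open>X * P\<close> is \<open>P\<^sup>2 + X * P'\<close>, and \<open>X * P'\<close> is \<open>2 * n * G * (1 - G)\<close> because \<open>G\<close> is
  homogeneous of degree \<open>2 * n\<close> in \<open>X\<close>. Up to boundary terms that vanish at infinity, this
  determines the increment of \<open>Y - Z\<close> over the loop from that of \<open>t - Z t\<close>.
\<close>

lemma virial_identity:
  "2 * n * ((Y u - Z u) - (Y s - Z s)) + ((u - Z u) - (s - Z s)) = X u * P u - X s * P s"
proof -
  have "((\<lambda>t. 2 * n * (Y t - Z t) + (t - Z t) - X t * P t) has_real_derivative 0) (at t)" for t
  proof -
    let ?P' = "2 * n * b * X t ^ (2 * n - 1) * (1 - G t)"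
    have "((\<lambda>t. 2 * n * (Y t - Z t) + (t - Z t) - X t * P t) has_real_derivative
        2 * n * ((1 - G t) - (1 - G t)\<^sup>2) + (1 - (1 - G t)\<^sup>2) - (X t * ?P' + P t * P t)) (at t)"
      by (rule derivative_eq_intros X_deriv P_deriv Y_deriv Z_deriv refl | simp)+
    also have "2 * n * ((1 - G t) - (1 - G t)\<^sup>2) + (1 - (1 - G t)\<^sup>2) - (X t * ?P' + P t * P t) = 0"
      unfolding X_P_deriv using energy[of t] by (simp add: power2_eq_square algebra_simps)
    finally show ?thesis .
  qed
  from DERIV_isconst_all[OF allI[OF this], of u s] show ?thesis
    by (simp add: algebra_simps)
qed

lemma arc_slope_width: "arc_slope n (X t / width) = \<bar>P t\<bar>"
proof -
  have "1 - 2 * (X t / width) ^ (2*n) = 1 - G t"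
    using width_power width_pos by (simp add: power_divide field_simps)
  then have "arc_slope n (X t / width) = sqrt (max 0 (1 - (1 - G t)\<^sup>2))" by (simp add: arc_slope_def)
  also have "1 - (1 - G t)\<^sup>2 = (P t)\<^sup>2" using energy[of t] by simp
  finally show ?thesis by simp
qed

text \<open>
  For \<open>M = width\<close> the geodesic follows the gradient of the calibration, with sign \<open>+\<close> until the
  turning time and with sign \<open>-\<close> afterwards.
\<close>

lemma calibrated_before_turning:
  assumes "s \<le> u" "u \<le> t0"
  shows "u - s = (Z u - Z s) + (well_potential n width (X u) - well_potential n width (X s))"
proof -
  have "u - Z u - well_potential n width (X u) = s - Z s - well_potential n width (X s)"
  proof (rule DERIV_zero_imp_eq[OF \<open>s \<le> u\<close>])
    fix t assume "s \<le> t" "t \<le> u"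
    then have t: "t \<le> t0" using assms by simp
    show "((\<lambda>t. t - Z t - well_potential n width (X t)) has_real_derivative 0) (at t)"
    proof -
      have "((\<lambda>t. t - Z t - well_potential n width (X t)) has_real_derivative
          1 - (1 - G t)\<^sup>2 - arc_slope n (X t / width) * P t) (at t)"
        by (rule derivative_eq_intros Z_deriv X_potential_deriv[OF width_pos] refl | simp)+
      also have "1 - (1 - G t)\<^sup>2 - arc_slope n (X t / width) * P t = 0"
        using energy[of t] t0(2)[OF t] by (simp add: arc_slope_width power2_eq_square)
      finally show ?thesis .
    qed
  qed
  then show ?thesis by simp
qed

lemma calibrated_after_turning:
  assumes "s \<le> u" "t0 \<le> s"
  shows "u - s = (Z u - Z s) - (well_potential n width (X u) - well_potential n width (X s))"
proof -
  have "u - Z u + well_potential n width (X u) = s - Z s + well_potential n width (X s)"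
  proof (rule DERIV_zero_imp_eq[OF \<open>s \<le> u\<close>])
    fix t assume "s \<le> t" "t \<le> u"
    then have t: "t0 \<le> t" using assms by simp
    show "((\<lambda>t. t - Z t + well_potential n width (X t)) has_real_derivative 0) (at t)"
    proof -
      have "((\<lambda>t. t - Z t + well_potential n width (X t)) has_real_derivative
          1 - (1 - G t)\<^sup>2 + arc_slope n (X t / width) * P t) (at t)"
        by (rule derivative_eq_intros Z_deriv X_potential_deriv[OF width_pos] refl | simp)+
      also have "1 - (1 - G t)\<^sup>2 + arc_slope n (X t / width) * P t = 0"
        using energy[of t] t0(3)[OF t] by (simp add: arc_slope_width power2_eq_square)
      finally show ?thesis .
    qed
  qed
  then show ?thesis by simp
qed

text \<open>
  The calibrated halves give the increment \<open>D\<close> of \<open>t - Z t\<close> over the loop, the virial identity then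
  gives that of \<open>Y - Z\<close>, and the excess is a combination of the two.
\<close>

lemma excess_limit:
  assumes M: "M > 0"
  shows "((\<lambda>T. excess M (- T) T) \<longlongrightarrow>
     2 * well_potential n M M - 2 * well_potential n width width
       - (1 + multiplier M) * well_potential n width width / n) at_top"
proof -
  let ?K = "well_potential n"
  have bot: "filterlim uminus at_bot (at_top :: real filter)"
    by (rule filterlim_uminus_at_bot_at_top)
  have K0: "((\<lambda>t. ?K L (X t)) \<longlongrightarrow> 0) at_top" "((\<lambda>t. ?K L (X (- t))) \<longlongrightarrow> 0) at_top" if "L > 0" for L
  proof -
    have "isCont (?K L) 0" using well_potential_deriv[OF that] DERIV_isCont by blast
    from isCont_tendsto_compose[OF this X_top] isCont_tendsto_compose[OF this filterlim_compose[OF X_bot bot]]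
    show "((\<lambda>t. ?K L (X t)) \<longlongrightarrow> 0) at_top" "((\<lambda>t. ?K L (X (- t))) \<longlongrightarrow> 0) at_top"
      by (simp_all add: well_potential_0)
  qed
  have XP0: "((\<lambda>t. X t * P t) \<longlongrightarrow> 0) at_top" "((\<lambda>t. X (- t) * P (- t)) \<longlongrightarrow> 0) at_top"
  proof -
    have bd: "norm (X t * P t) \<le> X t" for t
      using P_abs_le[of t] X_pos[of t] by (simp add: abs_mult mult_left_le)
    show "((\<lambda>t. X t * P t) \<longlongrightarrow> 0) at_top"
      by (rule Lim_null_comparison[OF _ X_top]) (use bd in auto)
    show "((\<lambda>t. X (- t) * P (- t)) \<longlongrightarrow> 0) at_top"
      by (rule Lim_null_comparison[OF _ filterlim_compose[OF X_bot bot]]) (use bd in auto)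
  qed
  define D where "D T = 2 * ?K width width - ?K width (X (- T)) - ?K width (X T)" for T
  have D_lim: "(D \<longlongrightarrow> 2 * ?K width width - 0 - 0) at_top"
    unfolding D_def by (intro tendsto_intros K0 width_pos)
  have D_eq: "(T - Z T) - (- T - Z (- T)) = D T" if "T \<ge> \<bar>t0\<bar>" for T
  proof -
    have "- T \<le> t0" "t0 \<le> T" using that by linarith+
    from calibrated_before_turning[OF this(1) order_refl] calibrated_after_turning[OF this(2) order_refl]
    show ?thesis unfolding D_def width_def by linarith
  qed
  have "((\<lambda>T. (1 + multiplier M) * ((X T * P T - X (- T) * P (- T) - D T) / (2 * n)) - D T
      + 2 * ?K M M - ?K M (X (- T)) - ?K M (X T)) \<longlongrightarrow>
      (1 + multiplier M) * ((0 - 0 - (2 * ?K width width - 0 - 0)) / (2 * n)) - (2 * ?K width width - 0 - 0)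
      + 2 * ?K M M - 0 - 0) at_top"
    using n by (intro tendsto_intros K0 XP0 D_lim M) auto
  moreover have "eventually (\<lambda>T. (1 + multiplier M) * ((X T * P T - X (- T) * P (- T) - D T) / (2 * n)) - D T
      + 2 * ?K M M - ?K M (X (- T)) - ?K M (X T) = excess M (- T) T) at_top"
    using eventually_ge_at_top[of "\<bar>t0\<bar>"]
  proof eventually_elim
    case (elim T)
    let ?C = "(Y T - Z T) - (Y (-T) - Z (-T))"
    have "2 * n * ?C = X T * P T - X (- T) * P (- T) - D T"
      using virial_identity[of T "-T"] unfolding D_eq[OF elim] by (simp only: eq_diff_eq)
    then have C: "(X T * P T - X (- T) * P (- T) - D T) / (2 * n) = ?C"
      using n by (metis nonzero_mult_div_cancel_left of_nat_eq_0_iff mult_eq_0_iff not_one_le_zero zero_neq_numeral)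
    show ?case unfolding C unfolding excess_def D_eq[OF elim, symmetric] by (simp add: algebra_simps)
  qed
  ultimately have "((\<lambda>T. excess M (- T) T) \<longlongrightarrow>
      (1 + multiplier M) * ((0 - 0 - (2 * ?K width width - 0 - 0)) / (2 * n)) - (2 * ?K width width - 0 - 0)
      + 2 * ?K M M - 0 - 0) at_top"
    by (rule Lim_transform_eventually)
  moreover have "(0 - 0 - (2 * ?K width width - 0 - 0)) / (2 * n) = - (?K width width / n)" by simp
  ultimately have "((\<lambda>T. excess M (- T) T) \<longlongrightarrow> (1 + multiplier M) * (- (?K width width / n)) - (2 * ?K width width - 0 - 0)
      + 2 * ?K M M - 0 - 0) at_top" by (simp only:)
  also have "(1 + multiplier M) * (- (?K width width / n)) - (2 * ?K width width - 0 - 0)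
      + 2 * ?K M M - 0 - 0 = 2 * ?K M M - 2 * ?K width width - (1 + multiplier M) * ?K width width / n"
    by simp
  finally show ?thesis .
qed

text \<open>
  With \<open>r = width / M\<close> the limit is a positive multiple of \<open>r ^ (2 * n + 1) - (2 * n + 1) * r + 2 * n\<close>,
  which is nonnegative by Bernoulli's inequality and vanishes at \<open>r = 1\<close>. In this sense the geodesic
  is the best of all loops, whatever their width.
\<close>

lemma excess_limit_nonneg:
  assumes M: "M > 0"
  shows "0 \<le> 2 * well_potential n M M - 2 * well_potential n width width
       - (1 + multiplier M) * well_potential n width width / n"
proof -
  let ?k = "arc_integral n 1"
  have k: "?k \<ge> 0"
    using well_potential_mono[of 1 0 1 n] by (simp add: well_potential_def arc_integral)
  define r where "r = width / M"
  have r: "r > 0" using M width_pos by (simp add: r_def)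
  have mult: "multiplier M = - (r ^ (2 * n))"
  proof -
    have "b * width ^ (2*n) = 2" by (rule width_power)
    then show ?thesis using b M by (simp add: calibration_multiplier_def r_def power_divide field_simps)
  qed
  have "1 + real (2*n+1) * (r - 1) \<le> (1 + (r - 1)) ^ (2*n+1)"
    by (rule Bernoulli_inequality) (use r in simp)
  then have bern: "0 \<le> 2 * n - (2 * n + 1) * r + r * r ^ (2*n)" by (simp add: algebra_simps)
  have "2 * well_potential n M M - 2 * well_potential n width width
       - (1 + multiplier M) * well_potential n width width / n
     = M * ?k / n * (2 * n - (2 * n + 1) * r + r * r ^ (2*n))"
    using M width_pos n unfolding mult by (simp add: well_potential_def r_def field_simps)
  also have "\<dots> \<ge> 0" using bern k M by (intro mult_nonneg_nonneg) auto
  finally show ?thesis .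
qed

lemma excess_nonneg:
  assumes M: "M > 0"
    and tail: "\<And>t. t \<le> s \<Longrightarrow> X t \<le> M" "\<And>t. u \<le> t \<Longrightarrow> X t \<le> M"
  shows "0 \<le> excess M s u"
proof -
  have "eventually (\<lambda>T. excess M (- T) T \<le> excess M s u) at_top"
    using eventually_ge_at_top[of "max \<bar>s\<bar> \<bar>u\<bar>"]
    by eventually_elim (rule excess_antimono[OF M], use tail in auto)
  then have "2 * well_potential n M M - 2 * well_potential n width width
       - (1 + multiplier M) * well_potential n width width / n \<le> excess M s u"
    by (intro tendsto_upperbound[OF excess_limit[OF M]]) auto
  with excess_limit_nonneg[OF M] show ?thesis by linarith
qed

end

section \<open>Comparison with arbitrary horizontal curves\<close>

lemma ennreal_add_le: "ennreal (p + q) \<le> ennreal p + ennreal q"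
proof -
  have "ennreal (p + q) \<le> ennreal (max 0 p + max 0 q)" by (intro ennreal_leI) simp
  also have "\<dots> = ennreal (max 0 p) + ennreal (max 0 q)" by (rule ennreal_plus) auto
  also have "\<dots> = ennreal p + ennreal q" by (simp add: max_def ennreal_neg)
  finally show ?thesis .
qed

context homoclinic_well
begin

lemma well_potential_X_nonneg: "M > 0 \<Longrightarrow> 0 \<le> well_potential n M (X t)"
  using well_potential_mono[of M 0 "X t" n] X_pos[of t] by (simp add: well_potential_0)

lemma multiplier_width: "multiplier width = - 1"
  using width_power by (simp add: calibration_multiplier_def)

text \<open>
  The fold of the calibration at the point \<open>m\<close> of maximal \<open>\<bar>x\<bar>\<close> gives the bound \<open>excess\<close>, which needs
  \<open>X \<le> M\<close> on both tails of the geodesic. That holds if the segment contains the turning time or if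
  the competitor reaches the width of the well. Otherwise the whole competitor lies where the
  unfolded calibration for \<open>M = width\<close> is valid, and the segment follows it exactly.
\<close>

lemma duration_le_length:
  assumes hor: "horizontal_curve (magnetic_distribution F) a c \<sigma>" and "a < c" and "s \<le> u"
    and F: "\<And>x. poly F x = \<epsilon> * (1 - b * x ^ (2 * n))"
    and \<epsilon>: "\<epsilon>\<^sup>2 = 1" and \<delta>: "\<delta>\<^sup>2 = 1"
    and start: "\<sigma> a = (\<delta> * X s, \<epsilon> * Y s, Z s)" and stop: "\<sigma> c = (\<delta> * X u, \<epsilon> * Y u, Z u)"
  shows "ennreal (u - s) \<le> sr_length magnetic_metric a c \<sigma>"
proof -
  have \<epsilon>\<epsilon>: "\<epsilon> * (\<epsilon> * y) = y" for y using \<epsilon> by (metis mult.assoc mult_1 power2_eq_square)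
  have \<delta>_cases: "\<delta> = 1 \<or> \<delta> = -1" using \<delta> by (simp add: power2_eq_1_iff)
  have K\<delta>: "well_potential n M (\<eta> * x) = \<eta> * well_potential n M x" if "\<eta> = 1 \<or> \<eta> = -1" for M \<eta> x
    using that by (auto simp: well_potential_minus)
  have "continuous_on {a..c} \<sigma>"
    using hor by (simp add: horizontal_curve_def absolutely_continuous_curve_imp_continuous_on)
  then have "continuous_on {a..c} (\<lambda>t. \<bar>fst (\<sigma> t)\<bar>)"
    by (intro continuous_intros)
  moreover have "{a..c} \<noteq> {}" using \<open>a < c\<close> by simp
  ultimately obtain m where m: "m \<in> {a..c}" and max: "\<And>t. t \<in> {a..c} \<Longrightarrow> \<bar>fst (\<sigma> t)\<bar> \<le> \<bar>fst (\<sigma> m)\<bar>"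
    using continuous_attains_sup[OF compact_Icc] by blast
  define M where "M = \<bar>fst (\<sigma> m)\<bar>"
  have Xs: "X s \<le> M" and Xu: "X u \<le> M"
    using max[of a] max[of c] \<open>a < c\<close> X_pos[of s] X_pos[of u] \<delta>_cases by (auto simp: M_def start stop)
  have M: "M > 0" using Xs X_pos[of s] by linarith
  define \<eta> where "\<eta> = sgn (fst (\<sigma> m))"
  have \<eta>: "\<eta> = 1 \<or> \<eta> = -1" "fst (\<sigma> m) = \<eta> * M"
    using M by (auto simp: \<eta>_def M_def sgn_if)
  have \<eta>\<eta>: "\<eta>\<^sup>2 = 1" "(- \<eta>)\<^sup>2 = 1" using \<eta>(1) by auto
  have le_M: "\<And>t. t \<in> {a..c} \<Longrightarrow> \<bar>fst (\<sigma> t)\<bar> \<le> M" using max by (simp add: M_def)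
  let ?len = "\<lambda>s u. \<integral>\<^sup>+t\<in>{s..u}. ennreal (let v = vector_derivative \<sigma> (at t within {a..c}) in
       sqrt (magnetic_metric (\<sigma> t) v v)) \<partial>lebesgue"
  let ?S = "magnetic_calibration n b \<epsilon>"
  show ?thesis
  proof (cases "width \<le> M \<or> (s \<le> t0 \<and> t0 \<le> u)")
    case True
    have tails: "\<And>t. t \<le> s \<Longrightarrow> X t \<le> M" "\<And>t. u \<le> t \<Longrightarrow> X t \<le> M"
    proof -
      show "X t \<le> M" if "t \<le> s" for t
        using True X_le_width[of t] X_mono[OF that] Xs by linarith
      show "X t \<le> M" if "u \<le> t" for t
        using True X_le_width[of t] X_antimono[OF _ that] Xu by linarith
    qed
    have c1: "ennreal (?S M \<eta> (\<sigma> m) - ?S M \<eta> (\<sigma> a)) \<le> ?len a m"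
      by (rule magnetic_calibration_le_length[OF hor \<open>a < c\<close> _ _ _ F b M \<epsilon>])
        (use m le_M \<eta>\<eta> in auto)
    have c2: "ennreal (?S M (- \<eta>) (\<sigma> c) - ?S M (- \<eta>) (\<sigma> m)) \<le> ?len m c"
      by (rule magnetic_calibration_le_length[OF hor \<open>a < c\<close> _ _ _ F b M \<epsilon>])
        (use m le_M \<eta>\<eta> in auto)
    have "u - s \<le> (?S M \<eta> (\<sigma> m) - ?S M \<eta> (\<sigma> a)) + (?S M (- \<eta>) (\<sigma> c) - ?S M (- \<eta>) (\<sigma> m))"
    proof -
      have "0 \<le> excess M s u" by (rule excess_nonneg[OF M tails])
      moreover have "(?S M \<eta> (\<sigma> m) - ?S M \<eta> (\<sigma> a)) + (?S M (- \<eta>) (\<sigma> c) - ?S M (- \<eta>) (\<sigma> m))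
        = ((1 + multiplier M) * (Y u - Y s) - multiplier M * (Z u - Z s))
          + 2 * (\<eta> * (\<eta> * well_potential n M M)) - \<eta> * \<delta> * well_potential n M (X s) - \<eta> * \<delta> * well_potential n M (X u)"
        unfolding magnetic_calibration_def split_def start stop fst_conv snd_conv \<eta>(2)
          K\<delta>[OF \<eta>(1)] K\<delta>[OF \<delta>_cases] \<epsilon>\<epsilon> by (simp add: algebra_simps)
      moreover have "\<eta> * (\<eta> * well_potential n M M) = well_potential n M M" using \<eta>(1) by auto
      \<comment> \<open>If the competitor has its maximum on the side of the origin away from the geodesic, it must
        cross \<open>x = 0\<close>; as \<open>K\<^sub>M\<close> is odd, this only increases the bound.\<close>
      moreover have "\<eta> * \<delta> * well_potential n M (X t) \<le> well_potential n M (X t)" for t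
        using \<eta>(1) \<delta>_cases well_potential_X_nonneg[OF M, of t] by auto
      ultimately show ?thesis
        using \<open>\<And>t. \<eta> * \<delta> * well_potential n M (X t) \<le> well_potential n M (X t)\<close>[of s]
          \<open>\<And>t. \<eta> * \<delta> * well_potential n M (X t) \<le> well_potential n M (X t)\<close>[of u]
        unfolding excess_def by linarith
    qed
    then have "ennreal (u - s) \<le> ennreal (?S M \<eta> (\<sigma> m) - ?S M \<eta> (\<sigma> a))
        + ennreal (?S M (- \<eta>) (\<sigma> c) - ?S M (- \<eta>) (\<sigma> m))"
      by (rule order_trans[OF ennreal_leI ennreal_add_le])
    also have "\<dots> \<le> ?len a m + ?len m c" by (rule add_mono[OF c1 c2])
    also have "\<dots> = sr_length magnetic_metric a c \<sigma>"
      using sr_length_split[OF hor \<open>a < c\<close>, of m] m by simp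
    finally show ?thesis .
  next
    case False
    define \<tau> where "\<tau> = (if u \<le> t0 then \<delta> else - \<delta>)"
    have side: "u \<le> t0 \<or> t0 \<le> s" using False by linarith
    have "?S width \<tau> (\<sigma> c) - ?S width \<tau> (\<sigma> a)
      = (Z u - Z s) + \<tau> * (\<delta> * (well_potential n width (X u) - well_potential n width (X s)))"
      by (simp add: magnetic_calibration_def start stop K\<delta>[OF \<delta>_cases] multiplier_width algebra_simps)
    also have "\<dots> = u - s"
      using side calibrated_before_turning[OF \<open>s \<le> u\<close>] calibrated_after_turning[OF \<open>s \<le> u\<close>] \<delta>_cases
      by (auto simp: \<tau>_def)
    finally have "ennreal (u - s) = ennreal (?S width \<tau> (\<sigma> c) - ?S width \<tau> (\<sigma> a))" by simp
    also have "\<dots> \<le> ?len a c"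
    proof (rule magnetic_calibration_le_length[OF hor \<open>a < c\<close> _ _ _ F b width_pos \<epsilon>])
      show "\<bar>fst (\<sigma> t)\<bar> \<le> width" if "t \<in> {a..c}" for t
        using max[OF that] False by (simp add: M_def)
      show "\<tau>\<^sup>2 = 1" using \<delta> by (simp add: \<tau>_def)
    qed (use \<open>a < c\<close> in auto)
    also have "\<dots> = sr_length magnetic_metric a c \<sigma>" by (simp add: sr_length_def)
    finally show ?thesis .
  qed
qed

lemma duration_le_magnetic_dist:
  assumes "s \<le> u"
    and F: "\<And>x. poly F x = \<epsilon> * (1 - b * x ^ (2 * n))"
    and \<epsilon>: "\<epsilon>\<^sup>2 = 1" and \<delta>: "\<delta>\<^sup>2 = 1"
  shows "ennreal (u - s) \<le>
    sr_dist (magnetic_distribution F) magnetic_metric (\<delta> * X s, \<epsilon> * Y s, Z s) (\<delta> * X u, \<epsilon> * Y u, Z u)"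
  unfolding sr_dist_def
proof (rule Inf_greatest, clarify)
  fix a c \<sigma>
  assume "a \<le> c" and hor: "horizontal_curve (magnetic_distribution F) a c \<sigma>"
    and ends: "\<sigma> a = (\<delta> * X s, \<epsilon> * Y s, Z s)" "\<sigma> c = (\<delta> * X u, \<epsilon> * Y u, Z u)"
  show "ennreal (u - s) \<le> sr_length magnetic_metric a c \<sigma>"
  proof (cases "a = c")
    case False
    then show ?thesis using \<open>a \<le> c\<close> by (intro duration_le_length[OF hor _ assms ends]) simp
  next
    case True
    \<comment> \<open>Over a one-point interval the derivative is meaningless; a constant curve of length zero
      with the same end points serves instead.\<close>
    let ?\<kappa> = "\<lambda>t::real. \<sigma> a"
    have vd: "vector_derivative ?\<kappa> (at t within {a..a+1}) = 0" if "t \<in> {a..a+1}" for t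
      using that vector_derivative_within_cbox[of a "a+1" t ?\<kappa> 0] by simp
    have "horizontal_curve (magnetic_distribution F) a (a+1) ?\<kappa>"
      unfolding horizontal_curve_def
    proof (intro conjI always_eventually allI impI bexI)
      show "absolutely_continuous_curve a (a+1) ?\<kappa>"
        by (rule absolutely_continuous_curve_lipschitz[of 0]) (auto intro: lipschitz_onI)
      show "0 \<in> magnetic_distribution F (\<sigma> a)"
        by (simp add: magnetic_distribution_def split_def zero_prod_def)
    qed auto
    from duration_le_length[OF this _ assms] ends True
    have "ennreal (u - s) \<le> sr_length magnetic_metric a (a+1) ?\<kappa>" by simp
    also have "\<dots> = (\<integral>\<^sup>+t. 0 \<partial>(lebesgue :: real measure))"
      unfolding sr_length_def
      by (rule nn_integral_cong) (auto simp: indicator_def vd magnetic_metric_def zero_prod_def)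
    finally show ?thesis by simp
  qed
qed

end

section \<open>Homoclinic geodesics of the jet space\<close>

lemma metric_lineI:
  fixes \<gamma> :: "real \<Rightarrow> 'a::euclidean_space"
  assumes hor: "\<And>a b. a \<le> b \<Longrightarrow> horizontal_curve D a b \<gamma>"
    and len: "\<And>a b. a \<le> b \<Longrightarrow> sr_length g a b \<gamma> = ennreal (b - a)"
    and dist: "\<And>a b. a \<le> b \<Longrightarrow> ennreal (b - a) \<le> sr_dist D g (\<gamma> a) (\<gamma> b)"
  shows "metric_line D g \<gamma>"
proof -
  have eq: "sr_dist D g (\<gamma> a) (\<gamma> b) = ennreal (b - a)" if "a \<le> b" for a b
  proof (rule antisym)
    show "sr_dist D g (\<gamma> a) (\<gamma> b) \<le> ennreal (b - a)"
      unfolding sr_dist_def using hor[OF that] that len[OF that, symmetric]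
      by (intro Inf_lower) blast
  qed (rule dist[OF that])
  have "sr_geodesic D g \<gamma>"
    unfolding sr_geodesic_def
    by (intro conjI allI impI exI[of _ 1]) (auto simp: hor len eq)
  moreover have "\<bar>a - b\<bar> = b - a" if "a \<le> b" for a b :: real using that by simp
  ultimately show ?thesis
    unfolding metric_line_def by (auto simp: eq)
qed

lemma unit_speed_magnetic_curve:
  fixes x y z p :: "real \<Rightarrow> real"
  assumes x: "\<And>t. (x has_real_derivative p t) (at t)"
    and y: "\<And>t. (y has_real_derivative poly F (x t)) (at t)"
    and z: "\<And>t. (z has_real_derivative (poly F (x t))\<^sup>2) (at t)"
    and energy: "\<And>t. (p t)\<^sup>2 + (poly F (x t))\<^sup>2 = 1"
    and "a \<le> b"
  shows "horizontal_curve (magnetic_distribution F) a b (\<lambda>t. (x t, y t, z t))"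
    and "sr_length magnetic_metric a b (\<lambda>t. (x t, y t, z t)) = ennreal (b - a)"
proof -
  let ?c = "\<lambda>t. (x t, y t, z t)"
  let ?v = "\<lambda>t. (p t, poly F (x t), (poly F (x t))\<^sup>2)"
  have der: "(?c has_vector_derivative ?v t) (at t within S)" for t S
  proof (rule has_vector_derivative_at_within)
    show "(?c has_vector_derivative ?v t) (at t)"
      using x[of t] y[of t] z[of t] unfolding has_real_derivative_iff_has_vector_derivative
      by (intro has_vector_derivative_Pair)
  qed
  have p1: "\<bar>p t\<bar> \<le> 1" and F1: "(poly F (x t))\<^sup>2 \<le> 1" for t
  proof -
    have "(p t)\<^sup>2 \<le> 1" by (metis energy le_add_same_cancel1 zero_le_power2)
    then show "\<bar>p t\<bar> \<le> 1" by (simp add: abs_square_le_1)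
    show "(poly F (x t))\<^sup>2 \<le> 1" by (metis energy le_add_same_cancel2 zero_le_power2)
  qed
  have v3: "norm (?v t) \<le> 3" for t
  proof -
    have "norm (?v t) \<le> norm (p t) + (norm (poly F (x t)) + norm ((poly F (x t))\<^sup>2))"
      using norm_Pair_le[of "p t" "(poly F (x t), (poly F (x t))\<^sup>2)"]
        norm_Pair_le[of "poly F (x t)" "(poly F (x t))\<^sup>2"] by linarith
    also have "\<bar>poly F (x t)\<bar> \<le> 1" using F1[of t] by (simp add: abs_square_le_1)
    ultimately show ?thesis using p1[of t] F1[of t] by simp
  qed
  have "3-lipschitz_on UNIV ?c"
  proof (rule bounded_derivative_imp_lipschitz)
    show "(?c has_derivative (\<lambda>h. h *\<^sub>R ?v t)) (at t within UNIV)" for t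
      using der by (simp add: has_vector_derivative_def)
    show "onorm (\<lambda>h. h *\<^sub>R ?v t) \<le> 3" for t
    proof (rule onorm_le)
      fix h :: real
      have "\<bar>h\<bar> * norm (?v t) \<le> \<bar>h\<bar> * 3" by (intro mult_left_mono v3) simp
      then show "norm (h *\<^sub>R ?v t) \<le> 3 * norm h" by (simp only: norm_scaleR real_norm_def mult.commute)
    qed
  qed auto
  then have "absolutely_continuous_curve a b ?c"
    by (rule absolutely_continuous_curve_lipschitz)
  moreover have "\<exists>v\<in>magnetic_distribution F (?c t). (?c has_vector_derivative v) (at t within S)" for t S
  proof (rule bexI)
    show "(?c has_vector_derivative ?v t) (at t within S)" by (rule der)
    show "?v t \<in> magnetic_distribution F (?c t)"
      by (simp add: magnetic_distribution_def power2_eq_square)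
  qed
  ultimately show "horizontal_curve (magnetic_distribution F) a b ?c"
    unfolding horizontal_curve_def by (intro conjI always_eventually allI impI)
  show "sr_length magnetic_metric a b ?c = ennreal (b - a)"
  proof (cases "a = b")
    case True
    have "{a} \<in> null_sets lebesgue" by (simp flip: negligible_iff_null_sets)
    from nn_integral_null_set[OF this] show ?thesis by (simp add: sr_length_def True)
  next
    case False
    then have "vector_derivative ?c (at t within {a..b}) = ?v t" if "t \<in> {a..b}" for t
      using vector_derivative_within_cbox[of a b t ?c "?v t"] that der \<open>a \<le> b\<close> by simp
    then have "sr_length magnetic_metric a b ?c = (\<integral>\<^sup>+t. indicator {a..b} t \<partial>lebesgue)"
      unfolding sr_length_def using energy
      by (intro nn_integral_cong) (auto simp: indicator_def magnetic_metric_def power2_eq_square)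
    also have "\<dots> = ennreal (b - a)" using \<open>a \<le> b\<close> by simp
    finally show ?thesis .
  qed
qed

text \<open>
  Gronwall's argument in both directions of time.
\<close>

lemma zero_everywhere_if_log_derivative_bounded:
  fixes v v' :: "real \<Rightarrow> real"
  assumes der: "\<And>t. (v has_real_derivative v' t) (at t)"
    and bound: "\<And>t. \<bar>v' t\<bar> \<le> L * v t" and nonneg: "\<And>t. 0 \<le> v t" and zero: "v s = 0"
  shows "v t = 0"
proof (cases "s \<le> t")
  case True
  have "v t * exp (- L * t) \<le> v s * exp (- L * s)"
  proof (rule DERIV_nonpos_imp_nonincreasing[OF True])
    fix r
    have "((\<lambda>t. v t * exp (- L * t)) has_real_derivative (v' r - L * v r) * exp (- L * r)) (at r)"
      by (auto intro!: derivative_eq_intros der simp: algebra_simps)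
    moreover have "(v' r - L * v r) * exp (- L * r) \<le> 0"
      using bound[of r] by (intro mult_nonpos_nonneg) auto
    ultimately show "\<exists>y. ((\<lambda>t. v t * exp (- L * t)) has_real_derivative y) (at r) \<and> y \<le> 0" by blast
  qed
  then have "v t * exp (- L * t) \<le> 0" using zero by simp
  then show ?thesis using nonneg[of t] by (simp add: mult_le_0_iff)
next
  case False
  have "v t * exp (L * t) \<le> v s * exp (L * s)"
  proof (rule DERIV_nonneg_imp_nondecreasing[of t s])
    show "t \<le> s" using False by simp
  next
    fix r
    have "((\<lambda>t. v t * exp (L * t)) has_real_derivative (v' r + L * v r) * exp (L * r)) (at r)"
      by (auto intro!: derivative_eq_intros der simp: algebra_simps)
    moreover have "(v' r + L * v r) * exp (L * r) \<ge> 0"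
      using bound[of r] by (intro mult_nonneg_nonneg) auto
    ultimately show "\<exists>y. ((\<lambda>t. v t * exp (L * t)) has_real_derivative y) (at r) \<and> 0 \<le> y" by blast
  qed
  then have "v t * exp (L * t) \<le> 0" using zero by simp
  then show ?thesis using nonneg[of t] by (simp add: mult_le_0_iff)
qed

text \<open>
  The point \<open>x = 0\<close> is a rest point of a system with \<open>p\<^sup>2 = b * x ^ (2 * n) * (2 - b * x ^ (2 * n))\<close>.
  On the bounded region of this energy level \<open>\<bar>p\<bar>\<close> is at most a multiple of \<open>\<bar>x\<bar>\<close>, so an orbit that
  meets the rest point stays there.
\<close>

lemma well_orbit_zero:
  fixes x p :: "real \<Rightarrow> real"
  assumes n: "n \<ge> 1" and b: "b > 0"
    and x: "\<And>t. (x has_real_derivative p t) (at t)"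
    and energy: "\<And>t. (p t)\<^sup>2 + (1 - b * x t ^ (2 * n))\<^sup>2 = 1"
    and zero: "x s = 0"
  shows "x t = 0"
proof -
  define L where "L = sqrt (2 * b + 4)"
  have p_bound: "\<bar>p t\<bar> \<le> L * \<bar>x t\<bar>" for t
  proof -
    let ?w = "x t ^ (2 * n)"
    have w0: "0 \<le> ?w" by simp
    have p2: "(p t)\<^sup>2 = b * ?w * (2 - b * ?w)"
      using energy[of t] by (simp add: power2_eq_square algebra_simps)
    then have "0 \<le> b * ?w * (2 - b * ?w)" by (metis zero_le_power2)
    then have bw: "b * ?w \<le> 2" using mult_pos_neg[of "b * ?w" "2 - b * ?w"] by linarith
    have "x t ^ (2 * (n - 1)) \<le> 1 + ?w"
    proof (cases "\<bar>x t\<bar> \<le> 1")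
      case True
      then have "\<bar>x t\<bar> ^ (2 * (n - 1)) \<le> 1" by (intro power_le_one) auto
      then have "x t ^ (2 * (n - 1)) \<le> 1" by (simp add: power_even_abs)
      then show ?thesis using w0 by linarith
    next
      case False
      then have "\<bar>x t\<bar> ^ (2 * (n - 1)) \<le> \<bar>x t\<bar> ^ (2 * n)" by (intro power_increasing) auto
      then show ?thesis by (simp add: power_even_abs)
    qed
    moreover have w_eq: "?w = (x t)\<^sup>2 * x t ^ (2 * (n - 1))"
    proof -
      have "2 * n = 2 + 2 * (n - 1)" using n by simp
      then show ?thesis by (metis power_add)
    qed
    ultimately have "b * ?w \<le> b * ((x t)\<^sup>2 * (1 + ?w))"
      using b by (intro mult_left_mono) (auto simp: mult_left_mono)
    also have "\<dots> = (x t)\<^sup>2 * (b + b * ?w)" by (simp add: algebra_simps)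
    also have "\<dots> \<le> (x t)\<^sup>2 * (b + 2)" using bw by (intro mult_left_mono) auto
    finally have *: "b * ?w \<le> (x t)\<^sup>2 * (b + 2)" .
    have "(p t)\<^sup>2 \<le> b * ?w * 2" unfolding p2 using b w0 by (intro mult_left_mono) auto
    also have "\<dots> \<le> (L * \<bar>x t\<bar>)\<^sup>2"
      using * b by (simp add: L_def power_mult_distrib algebra_simps)
    finally have "\<bar>p t\<bar>\<^sup>2 \<le> (L * \<bar>x t\<bar>)\<^sup>2" by simp
    then show ?thesis by (rule power2_le_imp_le) (use b in \<open>simp add: L_def\<close>)
  qed
  have "(x t)\<^sup>2 = 0"
  proof (rule zero_everywhere_if_log_derivative_bounded[where v = "\<lambda>t. (x t)\<^sup>2" and v' = "\<lambda>t. 2 * x t * p t"])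
    show "((\<lambda>t. (x t)\<^sup>2) has_real_derivative 2 * x t * p t) (at t)" for t
      by (auto intro!: derivative_eq_intros x)
    show "\<bar>2 * x t * p t\<bar> \<le> (2 * L) * (x t)\<^sup>2" for t
    proof -
      have "\<bar>2 * x t * p t\<bar> = 2 * \<bar>x t\<bar> * \<bar>p t\<bar>" by (simp add: abs_mult)
      also have "\<dots> \<le> 2 * \<bar>x t\<bar> * (L * \<bar>x t\<bar>)" by (intro mult_left_mono p_bound) auto
      also have "\<dots> = (2 * L) * (\<bar>x t\<bar> * \<bar>x t\<bar>)" by (simp add: algebra_simps)
      finally show ?thesis by (simp add: power2_eq_square)
    qed
    show "(x s)\<^sup>2 = 0" using zero by simp
  qed simp
  then show ?thesis by simp
qed

lemma continuous_nonzero_sign: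
  fixes x :: "real \<Rightarrow> real"
  assumes "\<And>t. isCont x t" and nz: "\<And>t. x t \<noteq> 0"
  obtains \<delta> where "\<delta>\<^sup>2 = 1" "\<And>t. 0 < \<delta> * x t"
proof -
  have "connected (range x)"
    using assms by (intro connected_continuous_image continuous_at_imp_continuous_on) auto
  then have conn: "\<And>s t r. x s \<le> r \<Longrightarrow> r \<le> x t \<Longrightarrow> r \<in> range x"
    unfolding connected_iff_interval by blast
  have "sgn (x 0) * x t > 0" for t
  proof (rule ccontr)
    assume "\<not> sgn (x 0) * x t > 0"
    then have "0 \<in> range x"
      using conn[of 0 0 t] conn[of t 0 0] nz[of 0] nz[of t]
      by (auto simp: sgn_if not_less split: if_splits)
    then show False using nz by auto
  qed
  moreover have "(sgn (x 0))\<^sup>2 = 1" using nz[of 0] by (simp add: sgn_if)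
  ultimately show ?thesis using that by blast
qed

lemma hamiltonian_derivs:
  "deriv (\<lambda>q. hamiltonian F q x) p = p"
  "deriv (\<lambda>y. hamiltonian F p y) x = poly F x * poly (pderiv F) x"
proof -
  show "deriv (\<lambda>q. hamiltonian F q x) p = p"
    unfolding hamiltonian_def by (rule DERIV_imp_deriv) (auto intro!: derivative_eq_intros)
  show "deriv (\<lambda>y. hamiltonian F p y) x = poly F x * poly (pderiv F) x"
    unfolding hamiltonian_def
    by (rule DERIV_imp_deriv) (auto intro!: derivative_eq_intros)
qed

lemma jet_geodesic_projection_derivs:
  assumes "jet_geodesic k F I \<gamma>"
  shows "((\<lambda>s. snd (\<gamma> s) 0) has_real_derivative poly F (jet_x \<gamma> t)) (at t)"
    and "((\<lambda>s. \<Sum>l=0..k. fact l * coeff F l * snd (\<gamma> s) l) has_real_derivative (poly F (jet_x \<gamma> t))\<^sup>2) (at t)"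
proof -
  let ?x = "jet_x \<gamma> t"
  have th: "((\<lambda>s. snd (\<gamma> s) i) has_real_derivative (poly F ?x * (?x ^ i / fact i))) (at t)" if "i \<le> k" for i
  proof -
    let ?w = "jet_lincomb (jet_p \<gamma> t) (jet_X (\<gamma> t)) (poly F ?x) (jet_Y k (\<gamma> t))"
    have "((\<lambda>s. snd (\<gamma> s) i) has_real_derivative snd ?w i) (at t)"
      using assms by (simp only: jet_geodesic_def has_jet_velocity_def)
    also have "snd ?w i = poly F ?x * (?x ^ i / fact i)"
      using that by (simp add: jet_lincomb_def jet_X_def jet_Y_def jet_x_def)
    finally show ?thesis .
  qed
  show "((\<lambda>s. snd (\<gamma> s) 0) has_real_derivative poly F ?x) (at t)" using th[of 0] by simp
  have "((\<lambda>s. \<Sum>l=0..k. fact l * coeff F l * snd (\<gamma> s) l) has_real_derivative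
      (\<Sum>l=0..k. fact l * coeff F l * (poly F ?x * (?x ^ l / fact l)))) (at t)"
    by (intro DERIV_sum DERIV_cmult th) auto
  also have "(\<Sum>l=0..k. fact l * coeff F l * (poly F ?x * (?x ^ l / fact l))) = poly F ?x * (\<Sum>l\<le>k. coeff F l * ?x ^ l)"
    by (simp add: sum_distrib_left atLeast0AtMost mult.left_commute)
  also have "(\<Sum>l\<le>k. coeff F l * ?x ^ l) = poly F ?x"
    unfolding poly_altdef using assms
    by (intro sum.mono_neutral_right) (auto simp: jet_geodesic_def coeff_eq_0)
  finally show "((\<lambda>s. \<Sum>l=0..k. fact l * coeff F l * snd (\<gamma> s) l) has_real_derivative (poly F ?x)\<^sup>2) (at t)"
    by (simp add: power2_eq_square)
qed

theorem theorem40: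
  fixes n k :: nat and b :: real and F\<^sub>h :: "real poly" and \<gamma>\<^sub>h :: "real \<Rightarrow> jet"
  assumes "n \<ge> 1" and "b > 0" and "k \<ge> 2 * n"
    and "F\<^sub>h = 1 - monom b (2 * n) \<or> F\<^sub>h = - (1 - monom b (2 * n))"
    and "homoclinic_geodesic k F\<^sub>h \<gamma>\<^sub>h"
  shows "metric_line (magnetic_distribution F\<^sub>h) magnetic_metric (\<lambda>t. magnetic_projection k F\<^sub>h (\<gamma>\<^sub>h t))"
proof -
  define x p where "x = jet_x \<gamma>\<^sub>h" and "p = jet_p \<gamma>\<^sub>h"
  define y where "y t = snd (\<gamma>\<^sub>h t) 0" for t
  define z where "z t = (\<Sum>l=0..k. fact l * coeff F\<^sub>h l * snd (\<gamma>\<^sub>h t) l)" for t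
  obtain \<epsilon> :: real where \<epsilon>: "\<epsilon>\<^sup>2 = 1" and Fh: "F\<^sub>h = smult \<epsilon> (1 - monom b (2 * n))"
    using assms(4) that[of 1] that[of "-1"] by auto
  have \<epsilon>\<epsilon>: "\<epsilon> * (\<epsilon> * r) = r" for r using \<epsilon> by (metis mult.assoc mult_1 power2_eq_square)
  have F: "poly F\<^sub>h r = \<epsilon> * (1 - b * r ^ (2 * n))" for r by (simp add: Fh poly_monom)
  have F2: "(poly F\<^sub>h r)\<^sup>2 = (1 - b * r ^ (2 * n))\<^sup>2" for r by (simp add: F power_mult_distrib \<epsilon>)
  have F': "poly F\<^sub>h r * poly (pderiv F\<^sub>h) r = - (2 * n * b * r ^ (2 * n - 1) * (1 - b * r ^ (2 * n)))" for r
    by (simp add: Fh pderiv_smult pderiv_diff pderiv_monom poly_monom \<epsilon>\<epsilon> algebra_simps)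
  obtain I where geo: "jet_geodesic k F\<^sub>h I \<gamma>\<^sub>h" and orb: "homoclinic_orbit F\<^sub>h p x"
    using assms(5) by (auto simp: homoclinic_geodesic_def x_def p_def)
  have x': "(x has_real_derivative p t) (at t)"
    and p': "(p has_real_derivative 2 * n * b * x t ^ (2 * n - 1) * (1 - b * x t ^ (2 * n))) (at t)" for t
    using orb by (simp_all add: homoclinic_orbit_def hamiltonian_solution_def hamiltonian_derivs F')
  have energy: "(p t)\<^sup>2 + (1 - b * x t ^ (2 * n))\<^sup>2 = 1" for t
  proof -
    have "hamiltonian F\<^sub>h (p t) (x t) = 1 / 2"
      using geo unfolding jet_geodesic_def x_def p_def by blast
    then show ?thesis unfolding hamiltonian_def F2 by simp
  qed
  have y': "(y has_real_derivative poly F\<^sub>h (x t)) (at t)"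
    and z': "(z has_real_derivative (poly F\<^sub>h (x t))\<^sup>2) (at t)" for t
    using jet_geodesic_projection_derivs[OF geo] by (simp_all add: x_def y_def[abs_def] z_def[abs_def])
  have proj: "magnetic_projection k F\<^sub>h (\<gamma>\<^sub>h t) = (x t, y t, z t)" for t
    by (simp add: magnetic_projection_def split_def x_def jet_x_def y_def z_def)

  have nz: "x t \<noteq> 0" for t
  proof
    assume "x t = 0"
    then have x0: "x r = 0" for r
      using well_orbit_zero[OF assms(1,2) x' energy] by blast
    then have "p r = 0" for r using energy[of r] assms(1) by (simp add: power_0_left)
    with x0 have "(\<lambda>t. (p t, x t)) constant_on UNIV" by (auto simp: constant_on_def)
    then show False using orb by (simp add: homoclinic_orbit_def)
  qed
  obtain \<delta> where \<delta>: "\<delta>\<^sup>2 = 1" and pos: "\<And>t. 0 < \<delta> * x t"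
    using continuous_nonzero_sign[of x] x' nz DERIV_isCont by metis
  have \<delta>\<delta>: "\<delta> * (\<delta> * r) = r" for r using \<delta> by (metis mult.assoc mult_1 power2_eq_square)
  have \<delta>pow: "(\<delta> * r) ^ (2 * n) = r ^ (2 * n)" for r
    by (simp add: power_mult_distrib power_mult \<delta>)
  have \<delta>pow1: "(\<delta> * r) ^ (2 * n - 1) = \<delta> * r ^ (2 * n - 1)" for r
  proof -
    have "2 * n - 1 = Suc (2 * (n - 1))" using assms(1) by simp
    then have "\<delta> ^ (2 * n - 1) = \<delta>" by (simp add: power_mult \<delta>)
    then show ?thesis by (simp add: power_mult_distrib)
  qed

  obtain p0 x0 where eq: "equilibrium F\<^sub>h p0 x0"
    and lims: "((\<lambda>t. (p t, x t)) \<longlongrightarrow> (p0, x0)) at_top" "((\<lambda>t. (p t, x t)) \<longlongrightarrow> (p0, x0)) at_bot"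
    using orb by (auto simp: homoclinic_orbit_def)
  have xlim: "(x \<longlongrightarrow> x0) at_top" "(x \<longlongrightarrow> x0) at_bot" "(p \<longlongrightarrow> p0) at_top"
    using lims[THEN tendsto_snd] lims(1)[THEN tendsto_fst] by simp_all
  \<comment> \<open>At a limit point with vanishing momentum the energy forces \<open>F\<^sub>h x0 = \<plusminus>1\<close>, so an equilibrium
    there is a critical point of \<open>F\<^sub>h\<close>, and the origin is the only one.\<close>
  have "x0 = 0"
  proof -
    have "((\<lambda>t. (p t)\<^sup>2 + (1 - b * x t ^ (2 * n))\<^sup>2) \<longlongrightarrow> p0\<^sup>2 + (1 - b * x0 ^ (2 * n))\<^sup>2) at_top"
      by (intro tendsto_intros xlim)
    then have "p0\<^sup>2 + (1 - b * x0 ^ (2 * n))\<^sup>2 = 1"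
      unfolding energy by (simp add: tendsto_const_iff)
    moreover have "p0 = 0" and "poly F\<^sub>h x0 * poly (pderiv F\<^sub>h) x0 = 0"
      using eq by (simp_all add: equilibrium_def hamiltonian_derivs)
    ultimately show ?thesis using assms(1,2) by (auto simp: F')
  qed

  have unit: "(p t)\<^sup>2 + (poly F\<^sub>h (x t))\<^sup>2 = 1" for t unfolding F2 by (rule energy)
  interpret homoclinic_well n b "\<lambda>t. \<delta> * x t" "\<lambda>t. \<delta> * p t" "\<lambda>t. \<epsilon> * y t" z
  proof
    show "n \<ge> 1" "b > 0" by fact+
    show "((\<lambda>t. \<delta> * x t) has_real_derivative \<delta> * p t) (at t)" for t by (intro DERIV_cmult x')
    show "((\<lambda>t. \<delta> * p t) has_real_derivative
        2 * n * b * (\<delta> * x t) ^ (2 * n - 1) * (1 - b * (\<delta> * x t) ^ (2 * n))) (at t)" for t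
      using DERIV_cmult[OF p', of \<delta> t] unfolding \<delta>pow \<delta>pow1 by (simp add: ac_simps)
    show "(\<delta> * p t)\<^sup>2 + (1 - b * (\<delta> * x t) ^ (2 * n))\<^sup>2 = 1" for t
      using energy[of t] unfolding \<delta>pow by (simp add: power_mult_distrib \<delta>)
    show "0 < \<delta> * x t" for t by (rule pos)
    show "((\<lambda>t. \<delta> * x t) \<longlongrightarrow> 0) at_top" "((\<lambda>t. \<delta> * x t) \<longlongrightarrow> 0) at_bot"
      using xlim(1,2) \<open>x0 = 0\<close> by (simp_all add: tendsto_mult_right_zero)
    show "((\<lambda>t. \<epsilon> * y t) has_real_derivative 1 - b * (\<delta> * x t) ^ (2 * n)) (at t)" for t
      using DERIV_cmult[OF y', of \<epsilon> t] unfolding \<delta>pow F \<epsilon>\<epsilon> .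
    show "(z has_real_derivative (1 - b * (\<delta> * x t) ^ (2 * n))\<^sup>2) (at t)" for t
      using z'[of t] unfolding \<delta>pow F2 .
  qed
  show ?thesis
    unfolding proj
  proof (rule metric_lineI)
    fix s u :: real assume "s \<le> u"
    show "horizontal_curve (magnetic_distribution F\<^sub>h) s u (\<lambda>t. (x t, y t, z t))"
      "sr_length magnetic_metric s u (\<lambda>t. (x t, y t, z t)) = ennreal (u - s)"
      by (rule unit_speed_magnetic_curve[OF x' y' z' unit \<open>s \<le> u\<close>])+
    from duration_le_magnetic_dist[OF \<open>s \<le> u\<close> F \<epsilon> \<delta>]
    show "ennreal (u - s) \<le> sr_dist (magnetic_distribution F\<^sub>h) magnetic_metric (x s, y s, z s) (x u, y u, z u)"
      by (simp add: \<delta>\<delta> \<epsilon>\<epsilon>)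
  qed
qed

end
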